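(* Let $G$ be a graph with $n\ge 1$ vertices and independence number $\alpha(G)$. Let $$\tau=\frac{2\sqrt2}{\sqrt2-1}\qquad\text{and}\qquad r = 2\alpha(G)-\left\lceil \log_{\tau}\!\left(\frac{\tau\,\alpha(G)}{2}\right)\right\rceil .$$ Then the complete graph $K_{\lceil n/r\rceil}$ is a minor of $G$.
   Context: Graphs are finite and simple. $\alpha(G)$ denotes the maximum size of an independent set of $G$. $\tau\approx 6.83$. *)

theory Defs
  imports Complex_Main "Graph_Theory.Graph_Theory"
begin

text \<open>Finite simple graphs are the symmetric loop-free finite digraphs without
  parallel arcs, \<^locale>\<open>pair_graph\<close>: each edge is represented by both of its
  orientations.\<close>

definition independent_set :: "'a pair_pre_digraph \<Rightarrow> 'a set \<Rightarrow> bool" where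
  "independent_set G S \<longleftrightarrow> S \<subseteq> pverts G \<and> (\<forall>u\<in>S. \<forall>v\<in>S. (u, v) \<notin> parcs G)"

definition independence_number :: "'a pair_pre_digraph \<Rightarrow> nat" where
  "independence_number G = Max (card ` {S. independent_set G S})"

definition complete_graph :: "nat \<Rightarrow> nat pair_pre_digraph" where
  "complete_graph k = \<lparr> pverts = {..<k}, parcs = {(i, j). i < k \<and> j < k \<and> i \<noteq> j} \<rparr>"

lemma complete_digraph_complete_graph:
  "complete_digraph k (with_proj (complete_graph k))"
  unfolding complete_digraph_pair_def by (auto simp: complete_graph_def)

text \<open>The merged vertex keeps the name \<open>u\<close>. Loops are dropped, and parallel edges coincide
  because arcs are pairs, so the result is again simple.\<close>

definition contract_edge :: "'a pair_pre_digraph \<Rightarrow> 'a \<Rightarrow> 'a \<Rightarrow> 'a pair_pre_digraph" where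
  "contract_edge G u v =
     (let f = (\<lambda>x. if x = v then u else x)
      in \<lparr> pverts = f ` pverts G,
           parcs = {(f x, f y) | x y. (x, y) \<in> parcs G \<and> f x \<noteq> f y} \<rparr>)"

definition edge_contraction :: "'a pair_pre_digraph \<Rightarrow> 'a pair_pre_digraph \<Rightarrow> bool" where
  "edge_contraction G G' \<longleftrightarrow> (\<exists>u v. (u, v) \<in> parcs G \<and> G' = contract_edge G u v)"

text \<open>\<open>H\<close> is a minor of \<open>G\<close> if a graph isomorphic to \<open>H\<close> arises from a subgraph of \<open>G\<close> by
  a (possibly empty) sequence of edge contractions. The library notion \<^const>\<open>subgraph\<close>
  allows arbitrary subdigraphs, hence the requirement \<^term>\<open>pair_graph G'\<close>.\<close>

definition is_minor :: "'b pair_pre_digraph \<Rightarrow> 'a pair_pre_digraph \<Rightarrow> bool" where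
  "is_minor H G \<longleftrightarrow>
     (\<exists>G' G''. pair_graph G' \<and> subgraph (with_proj G') (with_proj G) \<and>
        edge_contraction\<^sup>*\<^sup>* G' G'' \<and> digraph_iso (with_proj G'') (with_proj H))"

definition tau :: real where
  "tau = 2 * sqrt 2 / (sqrt 2 - 1)"

end

(*
  Let h be the largest number of pairwise touching disjoint connected sets (a clique minor
  model) in G.  For a vertex set C and a model F outside C one proves, by induction on C,
    card C <= R (alpha C) * (h - card F) + (sum of rho (w X) over X in F),
  where w X is the independence number of the part of C not adjacent to X.  Here
  R a = 2a - L a and rho w = 2w - E w, with E and L growing like log_3.  If C is disconnected,
  the bound adds up over the pieces.  If C is connected, one either discards a member X with
  w X = alpha C, or enlarges some X by 2t vertices of C so that w X drops by t, or adds to F a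
  new connected Y within C with card Y <= 2v + 1 and alpha Y > v, which touches every X with
  w X <= v.  For one range of alpha C none of these moves suffices, and there the same induction
  is run with a second pair of saving functions.  C = V with F empty gives n <= R (alpha G) * h,
  and R (alpha G) <= r because 6 <= tau.
*)
theory Submission
  imports Defs
begin

text \<open>With E = 0 and L a = 1 for a > 0 the same scheme yields the Duchet-Meyniel bound n \<le>
  (2 alpha G - 1) h: every member is enlarged until w X = 0, and a single vertex starts a new one.
  Anything better comes from leaving members unfinished. A new Y is charged w Y \<le> alpha C - v -
  1, so L (alpha C) may be one more than E (alpha C - v - 1); but v has to be at least every w X.
  Enlarging X is free as long as E does not drop, so the only values of w X in the way are those
  where E jumps, the numbers beta k. The conflict arises when w X = beta (j+1) while alpha C - w X
  is too small for Y to save j. The recursion beta (j+1) = 3 beta j + 2 is what resolves it: for j >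
  0 and mid j = 2 beta j + 1 it says beta (j+1) = mid j + beta j + 1, so saving functions that
  restart after mid j are back at j + 1 exactly at beta (j+1), and the critical range of alpha C
  ends at 2 mid j.\<close>

definition indep :: "('a \<Rightarrow> 'a \<Rightarrow> bool) \<Rightarrow> 'a set \<Rightarrow> bool" where
  "indep E S \<longleftrightarrow> (\<forall>u\<in>S. \<forall>v\<in>S. \<not> E u v)"

text \<open>Connectedness is phrased through cuts, so no paths are needed. The empty set counts as
  connected, which is why \<open>model\<close> asks for nonempty members separately.\<close>

definition conn :: "('a \<Rightarrow> 'a \<Rightarrow> bool) \<Rightarrow> 'a set \<Rightarrow> bool" where
  "conn E C \<longleftrightarrow> (\<forall>A\<subseteq>C. A \<noteq> {} \<longrightarrow> A \<noteq> C \<longrightarrow> (\<exists>a\<in>A. \<exists>b\<in>C - A. E a b))"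

definition touch :: "('a \<Rightarrow> 'a \<Rightarrow> bool) \<Rightarrow> 'a set \<Rightarrow> 'a set \<Rightarrow> bool" where
  "touch E X Y \<longleftrightarrow> (\<exists>x\<in>X. \<exists>y\<in>Y. E x y)"

definition model :: "('a \<Rightarrow> 'a \<Rightarrow> bool) \<Rightarrow> 'a set set \<Rightarrow> bool" where
  "model E F \<longleftrightarrow> (\<forall>X\<in>F. X \<noteq> {} \<and> conn E X)
     \<and> (\<forall>X\<in>F. \<forall>Y\<in>F. X \<noteq> Y \<longrightarrow> X \<inter> Y = {} \<and> touch E X Y)"

section \<open>Independence numbers and connected sets\<close>

locale fin_graph =
  fixes V :: "'a set" and E :: "'a \<Rightarrow> 'a \<Rightarrow> bool"
  assumes finV: "finite V"
    and sym: "E x y \<Longrightarrow> E y x"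
    and irrefl: "\<not> E x x"
begin

definition alpha :: "'a set \<Rightarrow> nat" where
  "alpha C = Max (card ` {S. S \<subseteq> C \<and> indep E S})"

definition far :: "'a set \<Rightarrow> 'a set \<Rightarrow> 'a set" where
  "far X C = {c\<in>C. \<not> touch E X {c}}"

lemma fin: "C \<subseteq> V \<Longrightarrow> finite C"
  using finV finite_subset by blast

lemma indep_subset: "indep E S \<Longrightarrow> T \<subseteq> S \<Longrightarrow> indep E T"
  unfolding indep_def by blast

lemma card_le_alpha:
  assumes "finite C" "S \<subseteq> C" "indep E S"
  shows "card S \<le> alpha C"
  unfolding alpha_def using assms by (intro Max_ge) (auto simp: finite_subset)

lemma alpha_witness:
  assumes "finite C"
  obtains S where "S \<subseteq> C" "indep E S" "card S = alpha C"
proof -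
  let ?A = "{S. S \<subseteq> C \<and> indep E S}"
  have "{} \<in> ?A" by (simp add: indep_def)
  then have "card ` ?A \<noteq> {}" by blast
  moreover have "finite (card ` ?A)" using assms by simp
  ultimately have "Max (card ` ?A) \<in> card ` ?A" by (rule Max_in[rotated])
  then show thesis using that unfolding alpha_def by auto
qed

lemma alpha_mono:
  assumes "finite B" "A \<subseteq> B"
  shows "alpha A \<le> alpha B"
proof -
  have "finite A" using assms finite_subset by blast
  then obtain S where "S \<subseteq> A" "indep E S" "card S = alpha A" by (rule alpha_witness)
  then show ?thesis using card_le_alpha[of B S] assms by auto
qed

lemma alpha_le_card: "finite C \<Longrightarrow> alpha C \<le> card C"
  by (metis alpha_witness card_mono)

lemma alpha_empty [simp]: "alpha {} = 0"
  using alpha_le_card[of "{}"] by simp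

lemma alpha_pos: "finite C \<Longrightarrow> C \<noteq> {} \<Longrightarrow> 0 < alpha C"
proof -
  assume "finite C" "C \<noteq> {}"
  then obtain x where "x \<in> C" by blast
  then have "card {x} \<le> alpha C"
    using \<open>finite C\<close> by (intro card_le_alpha) (auto simp: indep_def irrefl)
  then show ?thesis by simp
qed

lemma alpha_Un_le:
  assumes "finite A" "finite B"
  shows "alpha (A \<union> B) \<le> alpha A + alpha B"
proof -
  obtain S where S: "S \<subseteq> A \<union> B" "indep E S" "card S = alpha (A \<union> B)"
    using alpha_witness[of "A \<union> B"] assms by auto
  have "card (S \<inter> A) \<le> alpha A" "card (S \<inter> B) \<le> alpha B"
    using assms S indep_subset[of S] by (auto intro!: card_le_alpha)
  moreover have "card S \<le> card (S \<inter> A) + card (S \<inter> B)"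
    using S card_Un_le[of "S \<inter> A" "S \<inter> B"] by (metis Int_Un_distrib inf.orderE)
  ultimately show ?thesis using S by simp
qed

lemma alpha_Un_ge:
  assumes "finite A" "finite B" "A \<inter> B = {}" "\<not> touch E A B"
  shows "alpha A + alpha B \<le> alpha (A \<union> B)"
proof -
  obtain S where S: "S \<subseteq> A" "indep E S" "card S = alpha A"
    using alpha_witness[OF assms(1)] .
  obtain T where T: "T \<subseteq> B" "indep E T" "card T = alpha B"
    using alpha_witness[OF assms(2)] .
  have "indep E (S \<union> T)"
    using S T assms(4) sym unfolding indep_def touch_def by blast
  then have "card (S \<union> T) \<le> alpha (A \<union> B)"
    using S T assms by (intro card_le_alpha) auto
  moreover have "card (S \<union> T) = card S + card T"
    using S T assms by (intro card_Un_disjoint) (auto simp: finite_subset)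
  ultimately show ?thesis using S T by simp
qed

lemma alpha_singleton [simp]: "alpha {x} = 1"
  using alpha_le_card[of "{x}"] alpha_pos[of "{x}"] by simp

lemma alpha_remove_le: "finite C \<Longrightarrow> alpha C \<le> Suc (alpha (C - {x}))"
  using alpha_Un_le[of "C - {x}" "{x}"] alpha_mono[of "(C - {x}) \<union> {x}" C] by fastforce

lemma alpha_insert_le: "finite C \<Longrightarrow> alpha (insert x C) \<le> Suc (alpha C)"
  using alpha_Un_le[of C "{x}"] by simp

lemma conn_Un:
  assumes "conn E A" "conn E B" "touch E A B \<or> A \<inter> B \<noteq> {}"
  shows "conn E (A \<union> B)"
  unfolding conn_def
proof (intro allI impI)
  fix S assume S: "S \<subseteq> A \<union> B" "S \<noteq> {}" "S \<noteq> A \<union> B"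
  have crossA: "\<exists>a\<in>S. \<exists>b\<in>A \<union> B - S. E a b" if "S \<inter> A \<noteq> {}" "S \<inter> A \<noteq> A"
    using assms(1)[unfolded conn_def, rule_format, of "S \<inter> A"] that by blast
  have crossB: "\<exists>a\<in>S. \<exists>b\<in>A \<union> B - S. E a b" if "S \<inter> B \<noteq> {}" "S \<inter> B \<noteq> B"
    using assms(2)[unfolded conn_def, rule_format, of "S \<inter> B"] that by blast
  show "\<exists>a\<in>S. \<exists>b\<in>A \<union> B - S. E a b"
  proof (rule ccontr)
    assume neg: "\<not> ?thesis"
    then have a: "S \<inter> A = {} \<or> A \<subseteq> S" and b: "S \<inter> B = {} \<or> B \<subseteq> S"
      using crossA crossB by auto
    have "(A \<subseteq> S \<and> S \<inter> B = {}) \<or> (B \<subseteq> S \<and> S \<inter> A = {})" using a b S by blast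
    then show False using assms(3) neg sym unfolding touch_def by blast
  qed
qed

lemma conn_singleton [simp]: "conn E {x}"
  unfolding conn_def by (metis subset_singletonD)

lemma conn_insert:
  assumes "conn E A" "\<exists>a\<in>A. E a x"
  shows "conn E (insert x A)"
  using conn_Un[of A "{x}"] assms by (simp add: touch_def)

lemma conn_leaves:
  assumes "conn E A" "v \<in> A" "\<And>x. x \<in> B \<Longrightarrow> E v x" "finite B"
  shows "conn E (A \<union> B)"
  using assms(4,3)
proof (induction B)
  case (insert x B)
  then have "conn E (insert x (A \<union> B))" using assms(2) by (intro conn_insert) auto
  then show ?case by simp
qed (use assms in simp)

lemma component_extend:
  assumes "finite T" "D \<subseteq> T" "conn E D"
  obtains D' where "D \<subseteq> D'" "D' \<subseteq> T" "conn E D'" "\<not> touch E D' (T - D')"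
proof -
  let ?P = "\<lambda>X. D \<subseteq> X \<and> X \<subseteq> T \<and> conn E X"
  have "\<exists>X. ?P X \<and> (\<forall>Y. ?P Y \<longrightarrow> card Y \<le> card X)"
    using assms by (intro ex_has_greatest_nat[of ?P D card "Suc (card T)"])
      (auto intro: le_imp_less_Suc card_mono)
  then obtain X where X: "?P X" "\<And>Y. ?P Y \<Longrightarrow> card Y \<le> card X" by blast
  have "\<not> touch E X (T - X)"
  proof
    assume "touch E X (T - X)"
    then obtain x y where xy: "x \<in> X" "y \<in> T" "y \<notin> X" "E x y" unfolding touch_def by blast
    then have "?P (insert y X)" using X(1) conn_insert[of X y] by blast
    then have "card (insert y X) \<le> card X" using X(2) by blast
    moreover have "finite X" using X(1) assms(1) finite_subset by blast
    ultimately show False using xy by simp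
  qed
  then show thesis using that X(1) by blast
qed

lemma not_connE:
  assumes "\<not> conn E C"
  obtains A where "A \<subseteq> C" "A \<noteq> {}" "A \<noteq> C" "\<not> touch E A (C - A)"
  using assms unfolding conn_def touch_def by blast

lemma conn_nontrivial_touch:
  assumes "conn E C" "A \<subseteq> C" "A \<noteq> {}" "A \<noteq> C"
  shows "touch E A (C - A)"
  using assms unfolding conn_def touch_def by blast

section \<open>Small connected sets with large independence number\<close>

lemma alpha_remove_eq:
  assumes "finite C" "S \<subseteq> C" "indep E S" "card S = alpha C" "alpha (C - {x}) < alpha C"
  shows "x \<in> S"
proof (rule ccontr)
  assume "x \<notin> S"
  then have "card S \<le> alpha (C - {x})" using assms by (intro card_le_alpha) auto
  then show False using assms by simp
qed

text \<open>Induction by splitting off the leaves \<open>L\<close> at a cut vertex \<open>v\<close>;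
  choosing the component \<open>D\<close> of the rest as large as possible ensures that nothing but
  leaves lies outside \<open>insert v D\<close>. Paths with an odd number of vertices attain the
  bound.\<close>

lemma card_le_of_noncut_critical:
  assumes "finite T" "conn E T" "T \<noteq> {}"
    and "\<And>x. x \<in> T \<Longrightarrow> conn E (T - {x}) \<Longrightarrow> alpha (T - {x}) < alpha T"
  shows "card T < 2 * alpha T"
  using assms
proof (induction "card T" arbitrary: T rule: less_induct)
  case less
  note finT = \<open>finite T\<close> and connT = \<open>conn E T\<close>
    and crit = less.prems(4)
  obtain I where I: "I \<subseteq> T" "indep E I" "card I = alpha T" by (rule alpha_witness[OF finT])
  have crit_in: "x \<in> I" if "x \<in> T" "conn E (T - {x})" for x
    using alpha_remove_eq[OF finT I crit] that by blast
  show ?case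
  proof (cases "\<forall>x\<in>T. conn E (T - {x})")
    case True
    then have "indep E T" using I crit_in indep_subset by (metis subsetI)
    then have "card T \<le> alpha T" by (intro card_le_alpha finT) auto
    moreover have "0 < alpha T" using alpha_pos finT less.prems by blast
    ultimately show ?thesis by linarith
  next
    case False
    let ?P = "\<lambda>(v, D). v \<in> T \<and> D \<subseteq> T - {v} \<and> D \<noteq> {} \<and> D \<noteq> T - {v} \<and> conn E D
      \<and> \<not> touch E D (T - {v} - D)"
    have cut: "\<exists>D. ?P (x, D) \<and> D0 \<subseteq> D" if H: "x \<in> T" "\<not> conn E (T - {x})" "conn E D0"
        "D0 \<noteq> {}" "D0 \<subseteq> T - {x}" for x D0
    proof -
      obtain D where D: "D0 \<subseteq> D" "D \<subseteq> T - {x}" "conn E D"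
          "\<not> touch E D (T - {x} - D)"
        by (rule component_extend[OF finite_Diff[OF finT] H(5,3)])
      have "D \<noteq> {}" "D \<noteq> T - {x}" using D(1,3) H(2,4) by auto
      then have "?P (x, D)" using D H(1,4) by simp
      then show ?thesis using D(1) by blast
    qed
    obtain x0 where x0: "x0 \<in> T" "\<not> conn E (T - {x0})" using False by blast
    then obtain y0 where "y0 \<in> T - {x0}" unfolding conn_def by blast
    then obtain D0 where "?P (x0, D0)" using cut[OF x0, of "{y0}"] by auto
    moreover have "\<forall>p. ?P p \<longrightarrow> card (snd p) < Suc (card T)"
      using finT by (auto intro!: le_imp_less_Suc card_mono)
    ultimately have "\<exists>p. ?P p \<and> (\<forall>q. ?P q \<longrightarrow> card (snd q) \<le> card (snd p))"
      by (rule ex_has_greatest_nat[of ?P "(x0, D0)" "\<lambda>p. card (snd p)" "Suc (card T)"])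
    then obtain p where p: "?P p" "\<forall>q. ?P q \<longrightarrow> card (snd q) \<le> card (snd p)" by (elim exE conjE)
    obtain v D where pD: "p = (v, D)" by (cases p)
    have P: "?P (v, D)" using p(1) unfolding pD .
    have maxD: "card D' \<le> card D" if "?P (w, D')" for w D'
      using p(2)[THEN spec, of "(w, D')"] that pD by simp
    have vD: "v \<in> T" "D \<subseteq> T - {v}" "D \<noteq> {}" "D \<noteq> T - {v}" "conn E D"
        "\<not> touch E D (T - {v} - D)" using P by simp_all
    define L where "L = T - {v} - D"
    have L: "L \<noteq> {}" "L \<subseteq> T" "L \<inter> D = {}" "v \<notin> L" "v \<notin> D" "T = insert v (D \<union> L)"
      using vD unfolding L_def by auto
    have finD: "finite D" and finO: "finite L" using finT L by (auto intro: finite_subset)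
    have DO: "\<not> touch E D L" using vD(6) L_def by simp
    have "touch E D (T - D)" using conn_nontrivial_touch[OF connT, of D] vD L by blast
    then obtain d where d: "d \<in> D" "E d v" using DO L unfolding touch_def by blast
    have connDv: "conn E (insert v D)" using conn_insert vD(5) d by blast
    \<comment> \<open>A cut vertex in \<open>L\<close> would leave a component containing \<open>insert v D\<close>, against the
      maximality of \<open>D\<close>. So all of \<open>L\<close> lies in every maximum independent set, and consists of
      leaves at \<open>v\<close>.\<close>
    have L_crit: "conn E (T - {x})" if "x \<in> L" for x
    proof (rule ccontr)
      assume nc: "\<not> conn E (T - {x})"
      have "x \<in> T" "insert v D \<subseteq> T - {x}" using that L vD(1,2) by auto
      then have "\<exists>D'. ?P (x, D') \<and> insert v D \<subseteq> D'"
        using cut[OF _ nc connDv insert_not_empty] by blast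
      then obtain D' where D': "?P (x, D')" "insert v D \<subseteq> D'" by (elim exE conjE)
      then have "finite D'" using finT by (auto intro: finite_subset)
      then have "card (insert v D) \<le> card D'" using D'(2) by (rule card_mono)
      with maxD[OF D'(1)] have "card (insert v D) \<le> card D" by simp
      then show False using finD L by simp
    qed
    then have LI: "L \<subseteq> I" using crit_in L by blast
    then have indO: "indep E L" using I indep_subset by blast
    have leaf: "E v x" if "x \<in> L" for x
    proof -
      have "touch E {x} (T - {x})"
        using conn_nontrivial_touch[OF connT, of "{x}"] that L vD by blast
      then obtain y where "y \<in> T" "E x y" unfolding touch_def by blast
      moreover have "y \<notin> L" using indO that \<open>E x y\<close> unfolding indep_def by blast
      moreover have "y \<notin> D" using DO that \<open>E x y\<close> sym unfolding touch_def by blast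
      ultimately show ?thesis using L sym by blast
    qed
    have aO: "alpha L = card L"
      using card_le_alpha[OF finO _ indO] alpha_le_card[OF finO] by force
    have q: "card L \<ge> 1" using L(1) finO by (simp add: Suc_leI card_gt_0_iff)
    have cT: "card T = Suc (card D + card L)"
      using L finD finO by (simp add: card_Un_disjoint Int_commute)
    have aT: "alpha T = alpha D + card L"
    proof (rule antisym)
      have "v \<notin> I" using LI L(1) leaf I unfolding indep_def by blast
      then have "I \<subseteq> D \<union> L" using I L by blast
      then have "card I \<le> alpha (D \<union> L)" using I finD finO by (intro card_le_alpha) auto
      then show "alpha T \<le> alpha D + card L" using alpha_Un_le[OF finD finO] I aO by simp
      have "alpha (D \<union> L) \<le> alpha T" using L finT by (intro alpha_mono) auto
      then show "alpha D + card L \<le> alpha T"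
        using alpha_Un_ge[OF finD finO _ DO] L aO by (simp add: Int_commute)
    qed
    have critD: "alpha (D - {x}) < alpha D" if "x \<in> D" "conn E (T - {x})" for x
    proof -
      have "alpha (D - {x}) + alpha L \<le> alpha ((D - {x}) \<union> L)"
        using finD finO L DO by (intro alpha_Un_ge) (auto simp: touch_def)
      also have "\<dots> \<le> alpha (T - {x})" using finT L that by (intro alpha_mono) auto
      also have "\<dots> < alpha T" using crit that L by blast
      finally show ?thesis using aT aO by simp
    qed
    show ?thesis
    proof (cases "\<forall>x\<in>D. conn E (D - {x}) \<longrightarrow> alpha (D - {x}) < alpha D")
      case True
      \<comment> \<open>Each leaf adds one vertex but 2 to the bound, and this surplus of at least 1
        pays for \<open>v\<close>.\<close>
      then have "card D < 2 * alpha D" using less.hyps[of D] cT finD vD by simp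
      then show ?thesis using q aT cT by simp
    next
      case False
      then obtain n where n: "n \<in> D" "conn E (D - {n})" "alpha (D - {n}) \<ge> alpha D"
        by (metis not_less)
      have "\<not> touch E (D - {n}) {v}"
      proof
        assume "touch E (D - {n}) {v}"
        then have "conn E (insert v (D - {n}))"
          using conn_insert n(2) unfolding touch_def by blast
        then have "conn E (insert v (D - {n}) \<union> L)" using leaf finO by (intro conn_leaves) auto
        moreover have "insert v (D - {n}) \<union> L = T - {n}" using n L by auto
        ultimately show False using critD[of n] n by simp
      qed
      \<comment> \<open>Thus \<open>n\<close> is the only neighbour of \<open>v\<close> in \<open>D\<close>, and the induction hypothesis
        is applied to \<open>insert v D\<close> instead of \<open>D\<close>.\<close>
      then have "alpha (D - {n}) + 1 \<le> alpha ((D - {n}) \<union> {v})"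
        using alpha_Un_ge[of "D - {n}" "{v}"] finD L by simp
      then have aDv: "Suc (alpha D) \<le> alpha (D - {n} \<union> {v})" using n by simp
      also have "\<dots> \<le> alpha (insert v D)" using finD by (intro alpha_mono) auto
      finally have aDv': "alpha (insert v D) = Suc (alpha D)"
        using alpha_insert_le[OF finD, of v] by simp
      \<comment> \<open>\<open>v\<close> counts in \<open>alpha (insert v D)\<close> but not in
        \<open>alpha T\<close>, where the leaves exclude it. The bound for \<open>insert v D\<close>
        is therefore 2 too large, and the surplus of at least two leaves is needed to make up for
        it.\<close>
      have "card L \<noteq> 1"
      proof
        assume "card L = 1"
        then obtain x where x: "L = {x}" by (auto simp: card_1_singleton_iff)
        then have "alpha (T - {x}) < alpha T" using crit L_crit L by blast
        moreover have "alpha (D - {n} \<union> {v}) \<le> alpha (T - {x})"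
          using finT L x by (intro alpha_mono) auto
        ultimately show False using aDv aT x by simp
      qed
      moreover have "card (insert v D) < 2 * alpha (insert v D)"
      proof (rule less.hyps)
        show "card (insert v D) < card T" using cT finD L q by simp
        fix x assume x: "x \<in> insert v D" and cx: "conn E (insert v D - {x})"
        show "alpha (insert v D - {x}) < alpha (insert v D)"
        proof (cases "x = v")
          case True
          then show ?thesis using aDv' L by simp
        next
          case False
          have "conn E ((insert v D - {x}) \<union> L)"
            using False leaf finO cx by (intro conn_leaves) auto
          moreover have "(insert v D - {x}) \<union> L = T - {x}" using False L x by auto
          ultimately have "alpha (D - {x}) < alpha D" using critD[of x] False x by simp
          moreover have "insert v D - {x} = insert v (D - {x})" using False by auto
          ultimately show ?thesis using alpha_insert_le[of "D - {x}" v] finD aDv' by simp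
        qed
      qed (use finD connDv in auto)
      ultimately show ?thesis using cT aT aDv' q finD L by simp
    qed
  qed
qed

text \<open>A largest connected proper subset misses only one vertex, since any vertex adjacent to
  it could be added.\<close>

lemma ex_noncut:
  assumes "finite C" "conn E C" "C \<noteq> {}"
  obtains x where "x \<in> C" "conn E (C - {x})"
proof -
  let ?P = "\<lambda>D. D \<subset> C \<and> conn E D"
  have "?P {}" using assms by (auto simp: conn_def)
  moreover have "\<forall>D. ?P D \<longrightarrow> card D < Suc (card C)"
    using assms(1) by (auto intro!: le_imp_less_Suc card_mono)
  ultimately obtain D where D: "?P D" and maxD: "\<And>Z. ?P Z \<Longrightarrow> card Z \<le> card D"
    using ex_has_greatest_nat[of ?P "{}" card "Suc (card C)"] by blast
  obtain x where x: "x \<in> C - D" "D \<noteq> {} \<Longrightarrow> \<exists>d\<in>D. E d x"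
    using D assms conn_nontrivial_touch[of C D] unfolding touch_def by blast
  then have "conn E (insert x D)" using D conn_insert[of D x] by (cases "D = {}") auto
  moreover have "card (insert x D) > card D"
    using D x(1) finite_subset[of D C] assms(1) by (simp add: psubset_imp_subset)
  ultimately have "\<not> insert x D \<subset> C" using maxD[of "insert x D"] by fastforce
  then have "insert x D = C" using D x(1) by blast
  then have "D = C - {x}" using x by blast
  then show thesis using that x D by blast
qed

text \<open>A smallest connected \<open>Y\<close> with \<open>y \<le> alpha Y\<close> works:
  removing a noncut vertex lowers \<open>alpha\<close> by at most one, so minimality forces
  \<open>alpha Y = y\<close> and makes every noncut vertex critical.\<close>

lemma ex_conn_alpha_ge:
  assumes "C \<subseteq> V" "conn E C" "1 \<le> y" "y \<le> alpha C"
  obtains Y where "Y \<subseteq> C" "conn E Y" "card Y < 2 * y" "y \<le> alpha Y"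
proof -
  let ?P = "\<lambda>Y. Y \<subseteq> C \<and> conn E Y \<and> y \<le> alpha Y"
  obtain Y where Y: "?P Y" and minY: "\<And>Z. ?P Z \<Longrightarrow> card Y \<le> card Z"
    using assms ex_has_least_nat[of ?P C card] by blast
  have finY: "finite Y" using Y assms fin by blast
  have Yne: "Y \<noteq> {}" using Y assms by auto
  have crit: "alpha (Y - {x}) < y" if "x \<in> Y" "conn E (Y - {x})" for x
  proof (rule ccontr)
    assume "\<not> ?thesis"
    then have "card Y \<le> card (Y - {x})" using minY[of "Y - {x}"] Y that by auto
    then show False using that finY by (meson card_Diff1_less not_le)
  qed
  show thesis
  proof (cases "alpha Y = y")
    case True
    then have "card Y < 2 * y"
      using card_le_of_noncut_critical[of Y] finY Yne Y crit by auto
    then show thesis using that Y by blast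
  next
    case False
    have "\<not> conn E (Y - {x})" if "x \<in> Y" for x
      using crit[OF that] alpha_remove_le[OF finY, of x] False Y by fastforce
    then show thesis using ex_noncut[OF finY _ Yne] Y by blast
  qed
qed

end

section \<open>Clique minor models and their enlargement\<close>

lemma modelI:
  assumes "\<And>X. X \<in> F \<Longrightarrow> X \<noteq> {}" "\<And>X. X \<in> F \<Longrightarrow> conn E X"
    and "\<And>X Y. X \<in> F \<Longrightarrow> Y \<in> F \<Longrightarrow> X \<noteq> Y \<Longrightarrow> X \<inter> Y = {}"
    and "\<And>X Y. X \<in> F \<Longrightarrow> Y \<in> F \<Longrightarrow> X \<noteq> Y \<Longrightarrow> touch E X Y"
  shows "model E F"
  unfolding model_def by (intro conjI ballI impI; rule assms)

lemma modelD:
  assumes "model E F" "X \<in> F"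
  shows "X \<noteq> {}" "conn E X" "Y \<in> F \<Longrightarrow> X \<noteq> Y \<Longrightarrow> X \<inter> Y = {}"
    "Y \<in> F \<Longrightarrow> X \<noteq> Y \<Longrightarrow> touch E X Y"
  using assms unfolding model_def by blast+

lemma model_insert:
  assumes F: "model E F" and X: "X \<noteq> {}" "conn E X"
    and new: "\<And>Y. Y \<in> F \<Longrightarrow> X \<inter> Y = {}" "\<And>Y. Y \<in> F \<Longrightarrow> touch E X Y"
      "\<And>Y. Y \<in> F \<Longrightarrow> touch E Y X"
  shows "model E (insert X F)"
proof (rule modelI)
  fix Y assume "Y \<in> insert X F"
  then show "Y \<noteq> {}" "conn E Y" using modelD(1,2)[OF F] X by blast+
next
  fix Y Z assume YZ: "Y \<in> insert X F" "Z \<in> insert X F" "Y \<noteq> Z"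
  consider "Y = X" "Z \<in> F" | "Z = X" "Y \<in> F" | "Y \<in> F" "Z \<in> F" using YZ by blast
  then show "Y \<inter> Z = {}"
    by cases (use new(1) modelD(3)[OF F] YZ(3) in blast)+
  consider "Y = X" "Z \<in> F" | "Z = X" "Y \<in> F" | "Y \<in> F" "Z \<in> F" using YZ by blast
  then show "touch E Y Z"
    by cases (use new(2,3) modelD(4)[OF F] YZ(3) in blast)+
qed

lemma model_subset: "model E F \<Longrightarrow> F' \<subseteq> F \<Longrightarrow> model E F'"
  by (rule modelI; rule modelD(1-4)[of E F]) auto

context fin_graph
begin

lemma touch_sym: "touch E X Y \<longleftrightarrow> touch E Y X"
  unfolding touch_def using sym by blast

lemma touch_mono: "touch E X Y \<Longrightarrow> X \<subseteq> X' \<Longrightarrow> Y \<subseteq> Y' \<Longrightarrow> touch E X' Y'"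
  unfolding touch_def by blast

lemma far_subset: "far X C \<subseteq> C"
  unfolding far_def by blast

lemma far_mono: "X' \<subseteq> X \<Longrightarrow> C \<subseteq> C' \<Longrightarrow> far X C \<subseteq> far X' C'"
  unfolding far_def touch_def by blast

lemma far_Un: "far X (A \<union> B) = far X A \<union> far X B"
  unfolding far_def by blast

lemma alpha_far_mono:
  assumes "finite C'" "X' \<subseteq> X" "C \<subseteq> C'"
  shows "alpha (far X C) \<le> alpha (far X' C')"
  using assms by (intro alpha_mono far_mono) (auto intro: finite_subset[OF far_subset])

lemma alpha_far_le: "finite C \<Longrightarrow> alpha (far X C) \<le> alpha C"
  by (intro alpha_mono far_subset)

lemma alpha_Un_eq:
  assumes "finite A" "finite B" "A \<inter> B = {}" "\<not> touch E A B"
  shows "alpha (A \<union> B) = alpha A + alpha B"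
  using alpha_Un_le alpha_Un_ge assms by (simp add: le_antisym)

text \<open>Each round adds an edge \<open>a b\<close> that leaves \<open>far X C\<close>, with
  \<open>a\<close> inside. Whatever stays far is not adjacent to \<open>a\<close>, so
  \<open>a\<close> could be added to any independent set there: two vertices lower the independence
  number of the far part by at least one.\<close>

lemma ex_extension:
  assumes "finite C" "conn E C" "conn E X" "touch E X C"
  shows "\<exists>S\<subseteq>C. conn E (X \<union> S) \<and> card S \<le> 2 * (alpha (far X C) - v)
    \<and> alpha (far (X \<union> S) C) \<le> v"
  using assms(3,4)
proof (induction "alpha (far X C)" arbitrary: X rule: less_induct)
  case less
  show ?case
  proof (cases "alpha (far X C) \<le> v")
    case True
    then show ?thesis using less.prems by (intro exI[of _ "{}"]) auto
  next
    case False
    then have "far X C \<noteq> {}" by auto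
    moreover have "far X C \<noteq> C" using less.prems(2) unfolding far_def touch_def by blast
    ultimately have "touch E (far X C) (C - far X C)"
      using conn_nontrivial_touch[OF assms(2) far_subset] by blast
    then obtain a b where ab: "a \<in> far X C" "b \<in> C" "b \<notin> far X C" "E a b"
      unfolding touch_def by blast
    then obtain x where x: "x \<in> X" "E x b" unfolding far_def touch_def by blast
    let ?X = "insert a (insert b X)"
    have aC: "a \<in> C" using ab far_subset by blast
    have conn': "conn E ?X"
      using less.prems(1) ab x sym by (intro conn_insert) auto
    have touch': "touch E ?X C" using less.prems(2) by (rule touch_mono) auto
    have finf: "finite (far ?X C)" by (rule finite_subset[OF far_subset assms(1)])
    have "a \<notin> far ?X C" "\<not> touch E (far ?X C) {a}"
      using ab(4) sym unfolding far_def touch_def by blast+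
    then have "alpha (far ?X C) + 1 \<le> alpha (far ?X C \<union> {a})"
      using alpha_Un_ge[OF finf, of "{a}"] by simp
    also have "\<dots> \<le> alpha (far X C)"
      using ab(1) far_mono[of X ?X C C] finite_subset[OF far_subset assms(1)]
      by (intro alpha_mono) auto
    finally have dec: "Suc (alpha (far ?X C)) \<le> alpha (far X C)" by simp
    then obtain S where S: "S \<subseteq> C" "conn E (?X \<union> S)"
        "card S \<le> 2 * (alpha (far ?X C) - v)" "alpha (far (?X \<union> S) C) \<le> v"
      using less.hyps[of ?X] conn' touch' by auto
    have "card (insert a (insert b S)) \<le> Suc (Suc (card S))"
      using finite_subset[OF S(1) assms(1)] by (simp add: card_insert_if)
    then have "card (insert a (insert b S)) \<le> 2 * (alpha (far X C) - v)"
      using S(3) dec False by linarith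
    moreover have "?X \<union> S = X \<union> insert a (insert b S)" by blast
    ultimately show ?thesis using S aC ab(2)
      by (intro exI[of _ "insert a (insert b S)"]) auto
  qed
qed

lemma model_extend:
  assumes F: "model E F" "X \<in> F" and S: "\<Union>F \<inter> S = {}" "conn E (X \<union> S)"
  shows "model E (insert (X \<union> S) (F - {X}))"
proof (rule model_insert)
  show "model E (F - {X})" using F(1) by (rule model_subset) blast
  show "X \<union> S \<noteq> {}" using modelD(1)[OF F] by simp
  fix Y assume Y: "Y \<in> F - {X}"
  then have "X \<inter> Y = {}" "touch E X Y" using modelD(3,4)[OF F, of Y] by auto
  moreover have "S \<inter> Y = {}" using S(1) Y by blast
  ultimately show "(X \<union> S) \<inter> Y = {}" "touch E (X \<union> S) Y"
    using touch_mono[of X Y "X \<union> S" Y] by auto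
  then show "touch E Y (X \<union> S)" using touch_sym by simp
qed (fact S)

end

section \<open>Saving functions and costs\<close>

text \<open>A saving function \<open>f\<close> is what a cost \<open>2x - f x\<close> gains over the trivial cost \<open>2x\<close>.\<close>

definition saving :: "(nat \<Rightarrow> nat) \<Rightarrow> nat \<Rightarrow> bool" where
  "saving f N \<longleftrightarrow> (\<forall>x\<le>N. f x \<le> 2 * x) \<and> (\<forall>a b. a + b \<le> N \<longrightarrow> f (a + b) \<le> f a + f b)"

definition cost :: "(nat \<Rightarrow> nat) \<Rightarrow> nat \<Rightarrow> int" where
  "cost f x = 2 * int x - int (f x)"

lemma cost_mono: "saving f N \<Longrightarrow> a \<le> b \<Longrightarrow> b \<le> N \<Longrightarrow> cost f a \<le> cost f b"
proof -
  assume *: "saving f N" "a \<le> b" "b \<le> N"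
  then have "f (a + (b - a)) \<le> f a + f (b - a)" "f (b - a) \<le> 2 * (b - a)"
    unfolding saving_def by (metis le_add_diff_inverse, simp)
  then show ?thesis using * unfolding cost_def by simp
qed

lemma cost_nonneg: "saving f N \<Longrightarrow> a \<le> N \<Longrightarrow> 0 \<le> cost f a"
  unfolding saving_def cost_def by fastforce

lemma cost_superadd: "saving f N \<Longrightarrow> a + b \<le> N \<Longrightarrow> cost f a + cost f b \<le> cost f (a + b)"
  unfolding saving_def cost_def by force

section \<open>The weighted bound and the moves of the induction\<close>

locale fin_graph_bound = fin_graph +
  fixes h :: nat
  assumes card_model_le: "model E F \<Longrightarrow> \<Union>F \<subseteq> V \<Longrightarrow> card F \<le> h"
begin

text \<open>A budget for the vertices of \<open>C\<close>: each of the \<open>h - card F\<close>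
  places still open may use \<open>cost l (alpha C)\<close> of them, and each member
  \<open>X\<close> may absorb \<open>cost e (alpha (far X C))\<close> more.\<close>

definition bnd :: "(nat \<Rightarrow> nat) \<Rightarrow> (nat \<Rightarrow> nat) \<Rightarrow> 'a set \<Rightarrow> 'a set set \<Rightarrow> bool" where
  "bnd l e C F \<longleftrightarrow> int (card C) \<le> cost l (alpha C) * (int h - int (card F))
     + (\<Sum>X\<in>F. cost e (alpha (far X C)))"

definition all_bnd :: "(nat \<Rightarrow> nat) \<Rightarrow> (nat \<Rightarrow> nat) \<Rightarrow> 'a set \<Rightarrow> bool" where
  "all_bnd l e C \<longleftrightarrow> (\<forall>F. model E F \<longrightarrow> \<Union>F \<subseteq> V - C \<longrightarrow> bnd l e C F)"

lemma model_le: "model E F \<Longrightarrow> \<Union>F \<subseteq> V - C \<Longrightarrow> 0 \<le> int h - int (card F)"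
  using card_model_le[of F] by auto

lemma finite_model: "\<Union>F \<subseteq> V - C \<Longrightarrow> finite F"
  using finV by (meson Diff_subset finite_UnionD finite_subset)

lemma bnd_split:
  assumes "A \<union> B \<subseteq> V" "A \<inter> B = {}" "\<not> touch E A B"
    and F: "model E F" "\<Union>F \<subseteq> V - (A \<union> B)"
    and sav: "saving l (alpha (A \<union> B))" "saving e (alpha (A \<union> B))"
    and "bnd l e A F" "bnd l e B F"
  shows "bnd l e (A \<union> B) F"
proof -
  have fin: "finite A" "finite B" using assms(1) fin by auto
  have a: "alpha (A \<union> B) = alpha A + alpha B" using alpha_Un_eq fin assms by blast
  have w: "alpha (far X (A \<union> B)) = alpha (far X A) + alpha (far X B)" for X
    unfolding far_Un
  proof (rule alpha_Un_eq)
    show "finite (far X A)" "finite (far X B)" using fin finite_subset[OF far_subset] by blast+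
    show "far X A \<inter> far X B = {}" using assms(2) far_subset by blast
    show "\<not> touch E (far X A) (far X B)"
      using assms(3) touch_mono[OF _ far_subset far_subset] by blast
  qed
  have "(\<Sum>X\<in>F. cost e (alpha (far X A))) + (\<Sum>X\<in>F. cost e (alpha (far X B)))
      \<le> (\<Sum>X\<in>F. cost e (alpha (far X (A \<union> B))))"
    unfolding sum.distrib[symmetric]
  proof (rule sum_mono)
    fix X
    have "alpha (far X A) + alpha (far X B) \<le> alpha (A \<union> B)"
      using w alpha_far_le[of "A \<union> B" X] fin by simp
    then show "cost e (alpha (far X A)) + cost e (alpha (far X B)) \<le> cost e (alpha (far X (A \<union> B)))"
      using cost_superadd[OF sav(2)] w by simp
  qed
  moreover have "(cost l (alpha A) + cost l (alpha B)) * (int h - int (card F))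
      \<le> cost l (alpha (A \<union> B)) * (int h - int (card F))"
    using cost_superadd[OF sav(1)] a model_le[OF F] by (intro mult_right_mono) auto
  moreover have "card (A \<union> B) = card A + card B" using fin assms by (simp add: card_Un_disjoint)
  ultimately show ?thesis using assms(8,9) unfolding bnd_def by (simp add: distrib_right)
qed

text \<open>Putting back a member with \<open>alpha (far X C) = alpha C\<close> takes
  \<open>cost l (alpha C)\<close> from the first term and adds \<open>cost e (alpha C)\<close> to
  the sum, which is no less because \<open>e \<le> l\<close> at \<open>alpha C\<close>.\<close>

lemma bnd_drop:
  assumes "C \<subseteq> V" "model E F" "\<Union>F \<subseteq> V - C"
    and "e (alpha C) \<le> l (alpha C)"
    and "bnd l e C {X\<in>F. alpha (far X C) < alpha C}"
  shows "bnd l e C F"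
proof -
  let ?F = "{X\<in>F. alpha (far X C) < alpha C}"
  have finF: "finite F" using finite_model assms by blast
  have "(\<Sum>X\<in>F - ?F. cost l (alpha C)) \<le> (\<Sum>X\<in>F - ?F. cost e (alpha (far X C)))"
  proof (rule sum_mono)
    fix X assume "X \<in> F - ?F"
    then have "alpha (far X C) = alpha C" using alpha_far_le[of C X] fin assms(1) by force
    then show "cost l (alpha C) \<le> cost e (alpha (far X C))" using assms(4) unfolding cost_def by simp
  qed
  moreover have "(\<Sum>X\<in>F. cost e (alpha (far X C)))
      = (\<Sum>X\<in>F - ?F. cost e (alpha (far X C))) + (\<Sum>X\<in>?F. cost e (alpha (far X C)))"
    by (rule sum.subset_diff) (use finF in auto)
  moreover have "card F = card ?F + card (F - ?F)"
    using card_Int_Diff[OF finF, of ?F] by (simp add: Int_absorb1 Int_def)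
  ultimately show ?thesis using assms(5) unfolding bnd_def by (simp add: algebra_simps)
qed

text \<open>Lowering the independence number of the far part of \<open>X\<close> from w to
  \<open>v\<close> takes at most 2(w - v) vertices of \<open>C\<close>. The weight of
  \<open>X\<close> falls by at least that amount as soon as \<open>e w \<le> e v\<close>.\<close>

lemma bnd_extend:
  assumes C: "C \<subseteq> V" "conn E C" and F: "model E F" "\<Union>F \<subseteq> V - C"
    and sav: "saving l (alpha C)" "saving e (alpha C)"
    and X: "X \<in> F" "alpha (far X C) < alpha C" "v < alpha (far X C)"
      "e (alpha (far X C)) \<le> e v"
    and IH: "\<And>C'. C' \<subset> C \<Longrightarrow> all_bnd l e C'"
  shows "bnd l e C F"
proof -
  have finC: "finite C" using C fin by blast
  have finF: "finite F" using finite_model F by blast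
  have "touch E X C"
  proof (rule ccontr)
    assume "\<not> ?thesis"
    then have "far X C = C" unfolding far_def touch_def by blast
    then show False using X by simp
  qed
  then obtain S where S: "S \<subseteq> C" "conn E (X \<union> S)" "card S \<le> 2 * (alpha (far X C) - v)"
      "alpha (far (X \<union> S) C) \<le> v"
    using ex_extension[OF finC C(2) modelD(2)[OF F(1) X(1)], of v] by blast
  have "S \<noteq> {}" using S(4) X(3) by auto
  define C' where "C' = C - S"
  define F' where "F' = insert (X \<union> S) (F - {X})"
  have "model E F'" unfolding F'_def using F X S by (intro model_extend) auto
  moreover have "\<Union>F' \<subseteq> V - C'" using F C S X unfolding F'_def C'_def by blast
  moreover have "all_bnd l e C'" using IH S \<open>S \<noteq> {}\<close> unfolding C'_def by blast
  ultimately have b: "bnd l e C' F'" unfolding all_bnd_def by blast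
  have "X \<union> S \<notin> F - {X}" using modelD(1)[OF F(1) X(1)] modelD(3)[OF F(1) X(1), of "X \<union> S"] by auto
  moreover have "0 < card F" using X(1) finF by (auto simp: card_gt_0_iff)
  ultimately have cF: "card F' = card F"
    and sumF: "(\<Sum>Y\<in>F'. g Y) = g (X \<union> S) + (\<Sum>Y\<in>F - {X}. g Y)" for g :: "'a set \<Rightarrow> int"
    unfolding F'_def using finF X by simp_all
  have sumF0: "(\<Sum>Y\<in>F. g Y) = g X + (\<Sum>Y\<in>F - {X}. g Y)" for g :: "'a set \<Rightarrow> int"
    using finF X(1) by (rule sum.remove)
  have mono: "alpha (far Y C') \<le> alpha (far Y C)" for Y
    using finC C'_def by (intro alpha_far_mono) auto
  have "(\<Sum>Y\<in>F - {X}. cost e (alpha (far Y C'))) \<le> (\<Sum>Y\<in>F - {X}. cost e (alpha (far Y C)))"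
    by (intro sum_mono cost_mono[OF sav(2)] mono alpha_far_le finC)
  moreover have "cost e (alpha (far (X \<union> S) C')) \<le> cost e v"
    using S(4) mono[of "X \<union> S"] X by (intro cost_mono[OF sav(2)]) auto
  moreover have "cost l (alpha C') * (int h - int (card F)) \<le> cost l (alpha C) * (int h - int (card F))"
    using model_le[OF F] finC C'_def
    by (intro mult_right_mono cost_mono[OF sav(1)] alpha_mono) auto
  moreover have "card C = card C' + card S"
    using S(1) finC unfolding C'_def by (simp add: card_Diff_subset finite_subset card_mono)
  moreover have "cost e v + 2 * int (alpha (far X C) - v) \<le> cost e (alpha (far X C))"
    using X unfolding cost_def by simp
  ultimately show ?thesis using b S(3) unfolding bnd_def cF sumF sumF0 by linarith
qed

text \<open>Filling an open place with \<open>Y\<close> releases \<open>cost l (alpha C)\<close>,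
  which has to cover at most 2v + 1 vertices and the weight \<open>cost e (alpha C - Suc v)\<close>.
  Since 2v + 1 + 2(alpha C - v - 1) = 2 alpha C - 1, this is the condition
  \<open>l (alpha C) \<le> Suc (e (alpha C - Suc v))\<close>.\<close>

lemma bnd_new:
  assumes C: "C \<subseteq> V" "conn E C" and F: "model E F" "\<Union>F \<subseteq> V - C"
    and sav: "saving l (alpha C)" "saving e (alpha C)"
    and v: "v < alpha C" "l (alpha C) \<le> Suc (e (alpha C - Suc v))"
    and small: "\<And>X. X \<in> F \<Longrightarrow> alpha (far X C) \<le> v"
    and IH: "\<And>C'. C' \<subset> C \<Longrightarrow> all_bnd l e C'"
  shows "bnd l e C F"
proof -
  have finC: "finite C" using C fin by blast
  have finF: "finite F" using finite_model F by blast
  obtain Y where Y: "Y \<subseteq> C" "conn E Y" "card Y < 2 * Suc v" "Suc v \<le> alpha Y"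
    using ex_conn_alpha_ge[OF C, of "Suc v"] v by auto
  have "Y \<noteq> {}" using Y(4) by auto
  have touchY: "touch E X Y" if "X \<in> F" for X
  proof (rule ccontr)
    assume "\<not> ?thesis"
    then have "Y \<subseteq> far X C" using Y(1) unfolding far_def touch_def by blast
    then have "alpha Y \<le> alpha (far X C)" 
      using finite_subset[OF far_subset finC] by (intro alpha_mono)
    then show False using Y(4) small[OF that] by simp
  qed
  define C' where "C' = C - Y"
  have "Y \<notin> F" using F(2) Y(1) \<open>Y \<noteq> {}\<close> by blast
  have "Y \<inter> X = {}" if "X \<in> F" for X using F(2) Y(1) that by blast
  then have "model E (insert Y F)"
    using model_insert[OF F(1) \<open>Y \<noteq> {}\<close> Y(2)] touchY touch_sym by simp
  moreover have "\<Union>(insert Y F) \<subseteq> V - C'" using F C Y unfolding C'_def by blast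
  moreover have "all_bnd l e C'" using IH Y \<open>Y \<noteq> {}\<close> unfolding C'_def by blast
  \<comment> \<open>The new model itself certifies that a place was still open.\<close>
  ultimately have b: "bnd l e C' (insert Y F)" and le: "0 \<le> int h - int (card (insert Y F))"
    using model_le unfolding all_bnd_def by blast+
  have mono: "alpha (far X C') \<le> alpha (far X C)" for X
    using finC C'_def by (intro alpha_far_mono) auto
  have "alpha (far Y C') + alpha Y \<le> alpha (far Y C' \<union> Y)"
  proof (rule alpha_Un_ge)
    show "finite (far Y C')" using finC C'_def finite_subset[OF far_subset, of C'] by simp
    show "finite Y" using finite_subset[OF Y(1) finC] .
    show "far Y C' \<inter> Y = {}" using far_subset[of Y C'] unfolding C'_def by blast
    show "\<not> touch E (far Y C') Y" using sym unfolding far_def touch_def by blast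
  qed
  also have "\<dots> \<le> alpha C"
    using finC Y(1) far_subset[of Y C'] C'_def by (intro alpha_mono) auto
  finally have "alpha (far Y C') \<le> alpha C - Suc v" using Y(4) by simp
  then have "cost e (alpha (far Y C')) \<le> cost e (alpha C - Suc v)"
    by (intro cost_mono[OF sav(2)]) auto
  moreover have "(\<Sum>X\<in>F. cost e (alpha (far X C'))) \<le> (\<Sum>X\<in>F. cost e (alpha (far X C)))"
    by (intro sum_mono cost_mono[OF sav(2)] mono alpha_far_le finC)
  moreover have "cost l (alpha C') * (int h - int (card (insert Y F)))
      \<le> cost l (alpha C) * (int h - int (card (insert Y F)))"
    using le finC C'_def by (intro mult_right_mono cost_mono[OF sav(1)] alpha_mono) auto
  moreover have "card C = card C' + card Y"
    using Y(1) finC unfolding C'_def by (simp add: card_Diff_subset finite_subset card_mono)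
  moreover have "int (card Y) + cost e (alpha C - Suc v) \<le> cost l (alpha C)"
    using v Y(3) unfolding cost_def by simp
  ultimately show ?thesis
    using b finF \<open>Y \<notin> F\<close> unfolding bnd_def by (simp add: algebra_simps)
qed

text \<open>What is left to \<open>main\<close> is the stuck position: \<open>C\<close> is connected
  and nonempty, and each \<open>alpha (far X C)\<close> is below \<open>alpha C\<close> and a strict
  record of \<open>e\<close>.\<close>

lemma all_bnd_step:
  assumes "C \<subseteq> V" and sav: "saving l (alpha C)" "saving e (alpha C)"
    and drop: "e (alpha C) \<le> l (alpha C)"
    and IH: "\<And>C'. C' \<subset> C \<Longrightarrow> all_bnd l e C'"
    and main: "\<And>F. C \<noteq> {} \<Longrightarrow> conn E C \<Longrightarrow> model E F \<Longrightarrow> \<Union>F \<subseteq> V - C \<Longrightarrow>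
      (\<And>X. X \<in> F \<Longrightarrow> alpha (far X C) < alpha C) \<Longrightarrow>
      (\<And>X v. X \<in> F \<Longrightarrow> v < alpha (far X C) \<Longrightarrow> e v < e (alpha (far X C))) \<Longrightarrow> bnd l e C F"
  shows "all_bnd l e C"
  unfolding all_bnd_def
proof (intro allI impI)
  fix F0 assume F0: "model E F0" "\<Union>F0 \<subseteq> V - C"
  define F where "F = {X\<in>F0. alpha (far X C) < alpha C}"
  have "F \<subseteq> F0" unfolding F_def by blast
  then have F: "model E F" "\<Union>F \<subseteq> V - C" using model_subset[OF F0(1)] F0(2) by blast+
  have "bnd l e C F"
  proof (cases "conn E C")
    case False
    then obtain A where A: "A \<subseteq> C" "A \<noteq> {}" "A \<noteq> C" "\<not> touch E A (C - A)" by (rule not_connE)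
    then have AB: "A \<union> (C - A) = C" by blast
    have "all_bnd l e A" "all_bnd l e (C - A)" using IH A(1-3) by blast+
    moreover have "\<Union>F \<subseteq> V - A" "\<Union>F \<subseteq> V - (C - A)" using F(2) A(1) by blast+
    ultimately have "bnd l e A F" "bnd l e (C - A) F" using F(1) unfolding all_bnd_def by simp_all
    then have "bnd l e (A \<union> (C - A)) F"
      by (intro bnd_split) (simp_all only: AB assms(1) sav F A(4) Diff_disjoint not_False_eq_True)
    then show ?thesis by (simp only: AB)
  next
    case True
    consider "C = {}"
      | "\<exists>X\<in>F. \<exists>v<alpha (far X C). e (alpha (far X C)) \<le> e v"
      | "C \<noteq> {}" "\<forall>X\<in>F. \<forall>v<alpha (far X C). e v < e (alpha (far X C))"
      using not_less by blast
    then show ?thesis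
    proof cases
      case 1
      then have "F = {}" "cost l (alpha C) \<ge> 0" using cost_nonneg[OF sav(1)] unfolding F_def by auto
      then show ?thesis using 1 unfolding bnd_def by simp
    next
      case 2
      then obtain X v where X: "X \<in> F" "v < alpha (far X C)" "e (alpha (far X C)) \<le> e v" by blast
      then have "alpha (far X C) < alpha C" unfolding F_def by simp
      then show ?thesis by (rule bnd_extend[OF assms(1) True F sav X(1) _ X(2,3) IH])
    next
      case 3
      show ?thesis
      proof (rule main[OF 3(1) True F])
        show "alpha (far X C) < alpha C" if "X \<in> F" for X using that unfolding F_def by simp
      qed (use 3(2) in simp)
    qed
  qed
  then show "bnd l e C F0"
    unfolding F_def by (rule bnd_drop[where l = l and e = e, OF assms(1) F0 drop])
qed

end

section \<open>The levels and the first pair of saving functions\<close>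

text \<open>\<open>beta k\<close> is the least independence number \<open>w\<close> at which the saving \<open>lev w\<close> reaches \<open>k\<close>.\<close>

fun beta :: "nat \<Rightarrow> nat" where
  "beta 0 = 0"
| "beta (Suc 0) = 1"
| "beta (Suc (Suc k)) = 3 * beta (Suc k) + 2"

definition lev :: "nat \<Rightarrow> nat" where
  "lev w = Max {k. beta k \<le> w}"

lemma beta_Suc_ge: "3 * beta k + 2 \<le> beta (Suc k) \<or> k = 0"
  by (cases k) auto

lemma strict_mono_beta: "strict_mono beta"
  unfolding strict_mono_Suc_iff
proof
  fix k show "beta k < beta (Suc k)" by (cases k) auto
qed

lemma beta_le_iff [simp]: "beta i \<le> beta k \<longleftrightarrow> i \<le> k"
  using strict_mono_beta by (rule strict_mono_less_eq)

lemma beta_less_iff: "beta i < beta k \<longleftrightarrow> i < k"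
  using strict_mono_beta by (rule strict_mono_less)

lemma le_beta: "k \<le> beta k"
  using strict_mono_beta by (rule strict_mono_imp_increasing)

lemma beta_eq: "0 < k \<Longrightarrow> beta k + 1 = 2 * 3 ^ (k - 1)"
proof (induction k rule: beta.induct)
  case (3 k)
  then show ?case by simp
qed auto

lemma le_lev_iff: "k \<le> lev w \<longleftrightarrow> beta k \<le> w"
proof -
  have "{k. beta k \<le> w} \<subseteq> {..w}" using le_trans[OF le_beta] by auto
  then have fin: "finite {k. beta k \<le> w}" by (rule finite_subset) simp
  moreover have "0 \<in> {k. beta k \<le> w}" by simp
  ultimately have "lev w \<in> {k. beta k \<le> w}" unfolding lev_def by (intro Max_in) blast+
  then have "k \<le> lev w \<Longrightarrow> beta k \<le> w" using le_trans[of "beta k" "beta (lev w)" w] by simp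
  moreover have "beta k \<le> w \<Longrightarrow> k \<le> lev w" unfolding lev_def using fin by (intro Max_ge) auto
  ultimately show ?thesis by blast
qed

lemma beta_lev_le: "beta (lev w) \<le> w"
  using le_lev_iff by blast

lemma lev_less_iff: "lev w < k \<longleftrightarrow> w < beta k"
  using le_lev_iff[of k w] by linarith

lemma lev_beta [simp]: "lev (beta k) = k"
proof (rule antisym)
  show "lev (beta k) \<le> k" using beta_lev_le[of "beta k"] by simp
  show "k \<le> lev (beta k)" unfolding le_lev_iff by simp
qed

lemma lev_mono: "a \<le> b \<Longrightarrow> lev a \<le> lev b"
  unfolding le_lev_iff by (rule le_trans[OF beta_lev_le])

lemma lev_0 [simp]: "lev 0 = 0"
  using lev_beta[of 0] by simp

lemma lev_pos: "0 < w \<Longrightarrow> 1 \<le> lev w"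
  unfolding le_lev_iff by simp

lemma lev_le: "lev w \<le> w"
  by (rule le_trans[OF le_beta beta_lev_le])

lemma lev_double: "lev (2 * x + 1) \<le> Suc (lev x)"
proof (rule ccontr)
  assume "\<not> ?thesis"
  then have "beta (Suc (Suc (lev x))) \<le> 2 * x + 1" 
    by (simp only: le_lev_iff[symmetric] not_less_eq_eq)
  then have "beta (Suc (lev x)) \<le> x" by simp
  then show False by (simp only: le_lev_iff[symmetric] Suc_n_not_le_n)
qed

text \<open>A nonzero smaller summand has level at least 1, and passing from the larger summand b to
  2b + 1 gains no more than that.\<close>

lemma lev_add: "lev (a + b) \<le> lev a + lev b"
proof (induction a b rule: linorder_wlog)
  case (le a b)
  show ?case
  proof (cases "a = 0")
    case False
    have "lev (a + b) \<le> lev (2 * b + 1)" using le by (intro lev_mono) simp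
    then show ?thesis using lev_double[of b] lev_pos[of a] False by linarith
  qed simp
qed (simp add: add.commute)

lemma savingI:
  assumes "\<And>x. f x \<le> x" "\<And>a b. a + b \<le> N \<Longrightarrow> f (a + b) \<le> f a + f b"
  shows "saving f N"
proof -
  have "f x \<le> 2 * x" for x using assms(1)[of x] by simp
  then show ?thesis unfolding saving_def using assms(2) by simp
qed

lemma saving_lev: "saving lev N"
  by (rule savingI) (simp_all add: lev_add lev_le)

lemma lev_strict_record:
  assumes "\<And>v. v < w \<Longrightarrow> lev v < lev w"
  shows "w = beta (lev w)"
  using assms[of "beta (lev w)"] beta_lev_le[of w] by fastforce

text \<open>For \<open>a > 0\<close>, \<open>Suc j \<le> lsav a\<close> means
  \<open>2 * beta j + 1 \<le> a\<close>. With \<open>alpha C = a\<close> and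
  \<open>v = beta j\<close>, the value \<open>alpha C - Suc v\<close> charged to a new member is
  then at least \<open>beta j\<close> and saves at least \<open>j\<close>.\<close>

definition lsav :: "nat \<Rightarrow> nat" where
  "lsav a = (if a = 0 then 0 else Suc (lev ((a - 1) div 2)))"

lemma lsav_le: "lsav a \<le> a"
  unfolding lsav_def using lev_le[of "(a - 1) div 2"] by auto

lemma lsav_add: "lsav (a + b) \<le> lsav a + lsav b"
proof (cases "a = 0 \<or> b = 0")
  case False
  define x y where "x = (a - 1) div 2" and "y = (b - 1) div 2"
  have "(a + b - 1) div 2 \<le> (x + y) + 1" using False unfolding x_def y_def by linarith
  then have "lev ((a + b - 1) div 2) \<le> lev ((x + y) + 1)" by (rule lev_mono)
  also have "\<dots> \<le> lev (x + y) + lev 1" by (rule lev_add)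
  also have "\<dots> \<le> (lev x + lev y) + lev 1" using lev_add by simp
  finally show ?thesis using False lev_le[of 1] unfolding lsav_def x_def y_def by simp
qed (auto simp: lsav_def)

lemma saving_lsav: "saving lsav N"
  by (rule savingI) (simp_all add: lsav_add lsav_le)

lemma lev_le_lsav: "lev a \<le> lsav a"
proof (cases "a = 0")
  case False
  show ?thesis
  proof (cases "lev a \<le> 1")
    case False
    then obtain i where i: "lev a = Suc (Suc i)" by (metis One_nat_def not0_implies_Suc le_refl le0)
    then have "3 * beta (Suc i) + 2 \<le> a" using beta_lev_le[of a] by simp
    then have "beta (Suc i) \<le> (a - 1) div 2" by linarith
    then have "Suc i \<le> lev ((a - 1) div 2)" by (simp only: le_lev_iff)
    then show ?thesis using i \<open>a \<noteq> 0\<close> unfolding lsav_def by simp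
  qed (use False in \<open>simp add: lsav_def\<close>)
qed simp

section \<open>The second pair of saving functions\<close>

text \<open>When \<open>beta (Suc j) < alpha C \<le> beta (Suc j) + beta j\<close>, a member \<open>X\<close> with
  \<open>w X = beta (Suc j)\<close> is too large for a new set to be added, and enlarging \<open>X\<close> would lose
  saving under \<open>lev\<close>. The functions \<open>lsavQ j\<close> and \<open>levQ j\<close> restart the count at \<open>mid j\<close>; they
  agree with or improve on \<open>lsav\<close> and \<open>lev\<close> at the values that occur there, and allow every
  such \<open>X\<close> to be enlarged until \<open>w X \<le> mid j\<close>. They are subadditive only up to \<open>2 * mid j\<close>, which
  equals \<open>beta (Suc j) + beta j\<close> for \<open>j > 0\<close>.\<close>

definition mid :: "nat \<Rightarrow> nat" where
  "mid j = 2 * beta j + 1"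

definition lsavQ :: "nat \<Rightarrow> nat \<Rightarrow> nat" where
  "lsavQ j a = (if a \<le> mid j then lsav a else Suc (lev (a - mid j - 1)))"

definition levQ :: "nat \<Rightarrow> nat \<Rightarrow> nat" where
  "levQ j w = (if w < mid j then lev w else if w = mid j then Suc j else Suc (lev (w - mid j - 1)))"

lemma lev_mid_bound: "0 < j \<Longrightarrow> w \<le> mid j \<Longrightarrow> lev w \<le> j"
  using lev_less_iff[of w "Suc j"] beta_Suc_ge[of j] unfolding mid_def by linarith

lemma lsavQ_le: "lsavQ j a \<le> a"
  unfolding lsavQ_def using lsav_le[of a] lev_le[of "a - mid j - 1"] by auto

lemma levQ_le: "levQ j a \<le> a"
proof -
  have "Suc j \<le> mid j" using le_beta[of j] unfolding mid_def by simp
  then show ?thesis unfolding levQ_def using lev_le[of a] lev_le[of "a - mid j - 1"] by auto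
qed

lemma lsavQ_add_aux:
  assumes "a \<le> b" "a + b \<le> 2 * mid j"
  shows "lsavQ j (a + b) \<le> lsavQ j a + lsavQ j b"
proof -
  consider "a = 0" | "a + b \<le> mid j" | "mid j < b" | "0 < a" "mid j < a + b" "b \<le> mid j" by linarith
  then show ?thesis
  proof cases
    case 2
    then show ?thesis using lsav_add[of a b] unfolding lsavQ_def by simp
  next
    case 3
    then have "a + b - mid j - 1 = (b - mid j - 1) + a" by simp
    moreover have "a \<le> mid j" using assms 3 by linarith
    ultimately show ?thesis using 3 lev_add[of "b - mid j - 1" a] lev_le_lsav[of a]
      unfolding lsavQ_def by simp
  next
    case 4
    \<comment> \<open>As \<open>b \<le> mid j\<close>, the argument on the left is at most
      \<open>a - 1\<close>; the rounding in \<open>(a - 1) div 2\<close> loses at most 1.\<close>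
    have "lev (a + b - mid j - 1) \<le> lev (2 * ((a - 1) div 2) + 1)"
      using 4 by (intro lev_mono) linarith
    also have "\<dots> \<le> Suc (lev ((a - 1) div 2))" by (rule lev_double)
    finally show ?thesis using 4 assms(1) unfolding lsavQ_def lsav_def by simp
  qed (simp add: lsavQ_def lsav_def)
qed

lemma saving_lsavQ:
  assumes "N \<le> 2 * mid j"
  shows "saving (lsavQ j) N"
proof (rule savingI)
  fix a b assume "a + b \<le> N"
  then show "lsavQ j (a + b) \<le> lsavQ j a + lsavQ j b"
    using lsavQ_add_aux[of a b j] lsavQ_add_aux[of b a j] assms
    by (cases "a \<le> b") (simp_all add: add.commute)
qed (rule lsavQ_le)

lemma levQ_add_aux:
  assumes "0 < j" "a \<le> b" "a + b \<le> 2 * mid j"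
  shows "levQ j (a + b) \<le> levQ j a + levQ j b"
proof -
  consider "a = 0" | "a + b < mid j" | "0 < a" "a + b = mid j" | "mid j < b"
    | "0 < a" "b = mid j" | "0 < a" "mid j < a + b" "b < mid j" by linarith
  then show ?thesis
  proof cases
    case 1
    then show ?thesis by simp
  next
    case 2
    then show ?thesis using lev_add[of a b] unfolding levQ_def by simp
  next
    case 3
    \<comment> \<open>The jump of \<open>levQ j\<close> to \<open>Suc j\<close> at
      \<open>mid j\<close> stays subadditive: the larger summand already has level \<open>j\<close>,
      and the smaller one supplies the missing 1.\<close>
    then have "beta j \<le> b" using assms unfolding mid_def by linarith
    then have "j \<le> lev b" by (simp only: le_lev_iff)
    then show ?thesis using 3 lev_pos[of a] assms unfolding levQ_def by simp
  next
    case 4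
    then have "a + b - mid j - 1 = (b - mid j - 1) + a" by simp
    moreover have "a < mid j" using assms 4 by linarith
    ultimately show ?thesis using 4 lev_add[of "b - mid j - 1" a] unfolding levQ_def by simp
  next
    case 5
    have "lev (a - 1) \<le> j" using assms 5 by (intro lev_mid_bound) auto
    then show ?thesis using 5 assms unfolding levQ_def by simp
  next
    case 6
    have "lev (a + b - mid j - 1) \<le> lev b" using 6 assms by (intro lev_mono) linarith
    then show ?thesis using 6 lev_pos[of a] assms unfolding levQ_def by simp
  qed
qed

lemma saving_levQ:
  assumes "0 < j" "N \<le> 2 * mid j"
  shows "saving (levQ j) N"
proof (rule savingI)
  fix a b assume "a + b \<le> N"
  then show "levQ j (a + b) \<le> levQ j a + levQ j b"
    using levQ_add_aux[of j a b] levQ_add_aux[of j b a] assms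
    by (cases "a \<le> b") (simp_all add: add.commute)
qed (rule levQ_le)

section \<open>The simultaneous induction for both pairs\<close>

context fin_graph_bound
begin

lemma bnd_mono:
  assumes "model E F" "\<Union>F \<subseteq> V - C" "bnd l e C F"
    and "l' (alpha C) \<le> l (alpha C)"
    and "\<And>X. X \<in> F \<Longrightarrow> e' (alpha (far X C)) \<le> e (alpha (far X C))"
  shows "bnd l' e' C F"
proof -
  have "(\<Sum>X\<in>F. cost e (alpha (far X C))) \<le> (\<Sum>X\<in>F. cost e' (alpha (far X C)))"
    using assms(5) unfolding cost_def by (intro sum_mono) auto
  moreover have "cost l (alpha C) * (int h - int (card F)) \<le> cost l' (alpha C) * (int h - int (card F))"
    using model_le[OF assms(1,2)] assms(4) unfolding cost_def by (intro mult_right_mono) auto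
  ultimately show ?thesis using assms(3) unfolding bnd_def by linarith
qed

lemma all_bndD: "all_bnd l e C \<Longrightarrow> model E F \<Longrightarrow> \<Union>F \<subseteq> V - C \<Longrightarrow> bnd l e C F"
  unfolding all_bnd_def by blast

text \<open>Between \<open>mid j\<close> and \<open>2 * mid j\<close> the values of
  \<open>levQ j\<close> stay at most \<open>Suc j = levQ j (mid j)\<close>, so a stuck member has
  \<open>alpha (far X C) \<le> mid j\<close>. Then \<open>v = mid j\<close> fits, because
  \<open>alpha C - Suc (mid j) < mid j\<close>, where \<open>levQ j\<close> is
  \<open>lev\<close>.\<close>

lemma all_bnd_Q_step:
  assumes "C \<subseteq> V" and j: "0 < j" and a: "mid j < alpha C" "alpha C \<le> 2 * mid j"
    and IH: "\<And>C'. C' \<subset> C \<Longrightarrow> all_bnd (lsavQ j) (levQ j) C'"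
  shows "all_bnd (lsavQ j) (levQ j) C"
proof (rule all_bnd_step[OF assms(1) saving_lsavQ[OF a(2)] saving_levQ[OF j a(2)] _ IH])
  show "levQ j (alpha C) \<le> lsavQ j (alpha C)" using a unfolding levQ_def lsavQ_def by simp
next
  fix F assume conn: "conn E C" and F: "model E F" "\<Union>F \<subseteq> V - C"
    and small: "\<And>X. X \<in> F \<Longrightarrow> alpha (far X C) < alpha C"
    and stuck: "\<And>X v. X \<in> F \<Longrightarrow> v < alpha (far X C) \<Longrightarrow> levQ j v < levQ j (alpha (far X C))"
  show "bnd (lsavQ j) (levQ j) C F"
  proof (rule bnd_new[OF assms(1) conn F saving_lsavQ[OF a(2)] saving_levQ[OF j a(2)] a(1) _ _ IH])
    show "lsavQ j (alpha C) \<le> Suc (levQ j (alpha C - Suc (mid j)))"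
      using a unfolding levQ_def lsavQ_def by simp
    fix X assume X: "X \<in> F"
    show "alpha (far X C) \<le> mid j"
    proof (rule ccontr)
      assume gt: "\<not> ?thesis"
      then have "levQ j (mid j) < levQ j (alpha (far X C))" using stuck[OF X] by simp
      moreover have "lev (alpha (far X C) - mid j - 1) \<le> j"
        using small[OF X] a j by (intro lev_mid_bound) auto
      ultimately show False using gt unfolding levQ_def by simp
    qed
  qed
qed

text \<open>Up to \<open>mid j\<close> the two pairs differ only in \<open>levQ j (mid j)\<close>,
  which exceeds \<open>lev (mid j)\<close>. A member with \<open>alpha (far X C) = mid j\<close> has
  \<open>alpha (far X C) = alpha C\<close>, so it is dropped before the bounds are compared.\<close>

lemma all_bnd_Q_small:
  assumes "C \<subseteq> V" and "0 < j" and a: "alpha C \<le> mid j"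
    and P: "all_bnd lsav lev C"
  shows "all_bnd (lsavQ j) (levQ j) C"
  unfolding all_bnd_def
proof (intro allI impI)
  fix F0 assume F0: "model E F0" "\<Union>F0 \<subseteq> V - C"
  let ?F = "{X\<in>F0. alpha (far X C) < alpha C}"
  have "?F \<subseteq> F0" by simp
  then have F: "model E ?F" "\<Union>?F \<subseteq> V - C"
    using model_subset[OF F0(1)] subset_trans[OF Union_mono F0(2)] by simp_all
  have "bnd (lsavQ j) (levQ j) C ?F"
  proof (rule bnd_mono[OF F all_bndD[OF P F]])
    show "lsavQ j (alpha C) \<le> lsav (alpha C)" using a unfolding lsavQ_def by simp
    fix X assume "X \<in> ?F"
    then have "alpha (far X C) < mid j" using a by simp
    then show "levQ j (alpha (far X C)) \<le> lev (alpha (far X C))" unfolding levQ_def by simp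
  qed
  \<comment> \<open>At \<open>alpha C = mid j\<close> both sides are \<open>Suc j\<close>: the jump
    of \<open>levQ j\<close> is as high as dropping members permits.\<close>
  moreover have "levQ j (alpha C) \<le> lsavQ j (alpha C)"
  proof (cases "alpha C = mid j")
    case True
    then show ?thesis unfolding levQ_def lsavQ_def by (simp add: lsav_def mid_def)
  next
    case False
    then show ?thesis using a lev_le_lsav[of "alpha C"] unfolding lsavQ_def levQ_def by simp
  qed
  ultimately show "bnd (lsavQ j) (levQ j) C F0"
    by (intro bnd_drop[where l = "lsavQ j" and e = "levQ j", OF assms(1) F0])
qed

text \<open>With \<open>lsav a = Suc j\<close>, a new set for the parameter \<open>v\<close> needs
  \<open>v + Suc (beta j) \<le> a\<close>, while \<open>v\<close> must reach every
  \<open>alpha (far X C)\<close>. Stuck members have values \<open>beta i\<close> with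
  \<open>i \<le> Suc j\<close>, so \<open>v = beta j\<close> or \<open>v = beta (Suc j)\<close> does
  it unless \<open>a\<close> lies just above \<open>beta (Suc j)\<close>.\<close>

lemma all_bnd_P_step:
  assumes C: "C \<subseteq> V"
    and IH: "\<And>C'. C' \<subset> C \<Longrightarrow> all_bnd lsav lev C'"
    and Q: "\<And>j. 0 < j \<Longrightarrow> mid j < alpha C \<Longrightarrow> alpha C \<le> 2 * mid j \<Longrightarrow> all_bnd (lsavQ j) (levQ j) C"
  shows "all_bnd lsav lev C"
proof (rule all_bnd_step[OF C saving_lsav saving_lev lev_le_lsav IH])
  fix F assume ne: "C \<noteq> {}" and conn: "conn E C" and F: "model E F" "\<Union>F \<subseteq> V - C"
    and small: "\<And>X. X \<in> F \<Longrightarrow> alpha (far X C) < alpha C"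
    and stuck: "\<And>X v. X \<in> F \<Longrightarrow> v < alpha (far X C) \<Longrightarrow> lev v < lev (alpha (far X C))"
  define a where "a = alpha C"
  define m where "m = (a - 1) div 2"
  define j where "j = lev m"
  have apos: "0 < a" using alpha_pos[OF fin[OF C] ne] unfolding a_def .
  have bj: "2 * beta j + 1 \<le> a" using beta_lev_le[of m] apos unfolding m_def j_def by linarith
  have "m < beta (Suc j)" using lev_less_iff[of m "Suc j"] unfolding j_def by simp
  then have a_le: "a \<le> 2 * beta (Suc j)" unfolding m_def by linarith
  have lsav_a: "lsav a = Suc j" using apos unfolding lsav_def j_def m_def by simp
  have beta_w: "\<exists>i. alpha (far X C) = beta i" if "X \<in> F" for X
    using lev_strict_record stuck[OF that] by blast
  have new: "bnd lsav lev C F"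
    if v: "v + Suc (beta j) \<le> a" and w: "\<And>X. X \<in> F \<Longrightarrow> alpha (far X C) \<le> v" for v
  proof (rule bnd_new[OF C conn F saving_lsav saving_lev _ _ w IH])
    have "beta j \<le> a - Suc v" using v by simp
    then have "j \<le> lev (a - Suc v)" by (simp only: le_lev_iff)
    then show "lsav (alpha C) \<le> Suc (lev (alpha C - Suc v))" using lsav_a unfolding a_def by simp
    show "v < alpha C" using v unfolding a_def by simp
  qed
  have w_le: "alpha (far X C) \<le> beta (Suc j)" if "X \<in> F" for X
  proof -
    obtain i where i: "alpha (far X C) = beta i" using beta_w[OF \<open>X \<in> F\<close>] by blast
    have "a < beta (Suc (Suc j))" using a_le by simp
    then have "beta i < beta (Suc (Suc j))" using small[OF that] i unfolding a_def by simp
    then show ?thesis unfolding i beta_less_iff beta_le_iff by simp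
  qed
  consider "beta (Suc j) + Suc (beta j) \<le> a" | "a \<le> beta (Suc j)"
    | "0 < j" "beta (Suc j) < a" "a \<le> beta (Suc j) + beta j"
    by (cases "j = 0") (auto, linarith+)
  then show "bnd lsav lev C F"
  proof cases
    case 1
    then show ?thesis using new w_le by blast
  next
    case 2
    have "alpha (far X C) \<le> beta j" if "X \<in> F" for X
    proof -
      obtain i where i: "alpha (far X C) = beta i" using beta_w[OF \<open>X \<in> F\<close>] by blast
      then have "beta i < beta (Suc j)" using small[OF that] 2 unfolding a_def by simp
      then show ?thesis unfolding i beta_less_iff beta_le_iff by simp
    qed
    then show ?thesis using new[of "beta j"] bj by simp
  next
    case 3
    then have beta_Suc: "beta (Suc j) = mid j + beta j + 1"
      unfolding mid_def by (cases j) auto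
    then have a_mid: "mid j < a" "a \<le> 2 * mid j" using 3 unfolding mid_def by simp_all
    \<comment> \<open>Only values \<open>beta i\<close> with \<open>i \<le> Suc j\<close> occur for
      the members, and at these \<open>levQ j\<close> agrees with \<open>lev\<close>; at other
      values it can be smaller.\<close>
    then have "bnd (lsavQ j) (levQ j) C F" using all_bndD[OF Q[OF 3(1)] F] unfolding a_def by simp
    then show ?thesis
    proof (rule bnd_mono[OF F])
      have "beta j \<le> a - mid j - 1" using 3 beta_Suc by simp
      then have "j \<le> lev (a - mid j - 1)" by (simp only: le_lev_iff)
      then show "lsav (alpha C) \<le> lsavQ j (alpha C)"
        using lsav_a a_mid unfolding lsavQ_def a_def by simp
      fix X assume X: "X \<in> F"
      obtain i where i: "alpha (far X C) = beta i" using beta_w[OF X] by blast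
      have "i \<le> Suc j" using w_le[OF X] i by simp
      then consider "i \<le> j" | "i = Suc j" by linarith
      then show "lev (alpha (far X C)) \<le> levQ j (alpha (far X C))"
      proof cases
        case 1
        then have "beta i \<le> beta j" by simp
        then have "beta i < mid j" unfolding mid_def by linarith
        then show ?thesis using i unfolding levQ_def by simp
      next
        case 2
        then have "beta i - mid j - 1 = beta j" "mid j < beta i" using beta_Suc by simp_all
        then show ?thesis using i 2 unfolding levQ_def by simp
      qed
    qed
  qed
qed

text \<open>There is no circle at the same \<open>C\<close>: the first pair calls on the second only
  when \<open>mid j < alpha C\<close>, where the second rests on proper subsets alone, and the
  second calls on the first only when \<open>alpha C \<le> mid j\<close>. All \<open>j\<close> are
  carried along because the one that is needed depends on \<open>alpha C\<close>.\<close>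

lemma all_bnd_lsav_lev:
  assumes "C \<subseteq> V"
  shows "all_bnd lsav lev C
    \<and> (\<forall>j>0. alpha C \<le> 2 * mid j \<longrightarrow> all_bnd (lsavQ j) (levQ j) C)"
  using assms
proof (induction "card C" arbitrary: C rule: less_induct)
  case less
  have finC: "finite C" using fin less.prems by blast
  have IH: "all_bnd lsav lev C'"
    and IHQ: "\<And>j. 0 < j \<Longrightarrow> alpha C \<le> 2 * mid j \<Longrightarrow> all_bnd (lsavQ j) (levQ j) C'"
    if "C' \<subset> C" for C'
  proof -
    have *: "card C' < card C" "C' \<subseteq> V" using that finC psubset_card_mono less.prems by blast+
    then show "all_bnd lsav lev C'" using less.hyps by blast
    have "alpha C' \<le> alpha C" using that finC by (intro alpha_mono) auto
    then show "all_bnd (lsavQ j) (levQ j) C'" if "0 < j" "alpha C \<le> 2 * mid j" for j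
      using less.hyps[OF *] that le_trans by blast
  qed
  have Q: "all_bnd (lsavQ j) (levQ j) C" if "0 < j" "mid j < alpha C" "alpha C \<le> 2 * mid j" for j
    using all_bnd_Q_step[OF less.prems that] IHQ that by blast
  have P: "all_bnd lsav lev C" using all_bnd_P_step[OF less.prems IH Q] .
  moreover have "all_bnd (lsavQ j) (levQ j) C" if "0 < j" "alpha C \<le> 2 * mid j" for j
    using Q[OF that(1) _ that(2)] all_bnd_Q_small[OF less.prems that(1) _ P] by linarith
  ultimately show ?case by blast
qed

lemma card_le_cost_mult: "int (card V) \<le> cost lsav (alpha V) * int h"
proof -
  have "model E {}" unfolding model_def by simp
  then have "bnd lsav lev V {}" using all_bnd_lsav_lev[of V] all_bndD[of lsav lev V "{}"] by simp
  then show ?thesis unfolding bnd_def by simp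
qed

end

section \<open>Comparison with the logarithm\<close>

lemma tau_ge_6: "6 \<le> tau"
proof -
  have "1 < sqrt 2" by simp
  moreover have "sqrt 2 * sqrt 2 = 2" by simp
  ultimately have "tau = 4 + 2 * sqrt 2" unfolding tau_def by (simp add: field_simps)
  then show ?thesis using \<open>1 < sqrt 2\<close> by linarith
qed

text \<open>With \<open>lsav a = Suc e\<close> the claim amounts to
  \<open>a / 2 \<le> tau ^ e\<close>, whereas the choice of \<open>e\<close> gives
  \<open>a \<le> 2 * beta (Suc e) = 4 * 3 ^ e - 2\<close>.\<close>

lemma ceiling_log_tau_le:
  assumes "0 < a"
  shows "\<lceil>log tau (tau * real a / 2)\<rceil> \<le> int (lsav a)"
proof -
  define e where "e = lev ((a - 1) div 2)"
  have "(a - 1) div 2 < beta (Suc e)" using lev_less_iff[of _ "Suc e"] unfolding e_def by blast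
  then have "a \<le> 2 * beta (Suc e)" by linarith
  then have "a + 2 \<le> 4 * 3 ^ e" using beta_eq[of "Suc e"] by simp
  \<comment> \<open>At \<open>e = 0\<close> this is an equality, so the summand 2 on the right
    cannot be given away.\<close>
  also have "(4::nat) * 3 ^ e \<le> 2 * 6 ^ e + 2"
  proof (cases e)
    case (Suc i)
    have "(3::nat) ^ i \<le> 6 ^ i" by (rule power_mono) auto
    then show ?thesis using Suc by simp
  qed simp
  finally have "a \<le> 2 * 6 ^ e" by simp
  then have "real a \<le> real (2 * 6 ^ e)" by (rule of_nat_mono)
  then have "real a / 2 \<le> 6 ^ e" by simp
  also have "\<dots> \<le> tau ^ e" using tau_ge_6 by (intro power_mono) auto
  finally have "tau * (real a / 2) \<le> tau * tau ^ e" using tau_ge_6 by (intro mult_left_mono) auto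
  then have "tau * real a / 2 \<le> tau powr real (Suc e)"
    using tau_ge_6 by (subst powr_realpow) auto
  then have "log tau (tau * real a / 2) \<le> real (Suc e)"
    using tau_ge_6 assms by (subst log_le_iff) auto
  moreover have "lsav a = Suc e" using assms unfolding lsav_def e_def by simp
  ultimately show ?thesis by (simp add: ceiling_le_iff)
qed

section \<open>From models to minors by edge contraction\<close>

abbreviation adj :: "'a pair_pre_digraph \<Rightarrow> 'a \<Rightarrow> 'a \<Rightarrow> bool" where
  "adj H x y \<equiv> (x, y) \<in> parcs H"

lemma conn_mono:
  assumes "conn E C" "\<And>x y. x \<in> C \<Longrightarrow> y \<in> C \<Longrightarrow> E x y \<Longrightarrow> E' x y"
  shows "conn E' C"
  unfolding conn_def
proof (intro allI impI)
  fix A assume A: "A \<subseteq> C" "A \<noteq> {}" "A \<noteq> C"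
  then obtain a b where "a \<in> A" "b \<in> C - A" "E a b" using assms(1) unfolding conn_def by blast
  then show "\<exists>a\<in>A. \<exists>b\<in>C - A. E' a b" using assms(2) A(1) by blast
qed

text \<open>An edge inside a member with at least two vertices is contracted; that member shrinks
  but stays connected, and all contacts between members survive. Once all members are singletons,
  touching means that any two vertices are adjacent.\<close>

lemma contract_edge_to_complete:
  assumes "finite (pverts H)" "parcs H \<subseteq> {(x, y). x \<in> pverts H \<and> y \<in> pverts H \<and> x \<noteq> y}"
    and "model (adj H) F" "\<Union>F = pverts H"
  shows "\<exists>H'. edge_contraction\<^sup>*\<^sup>* H H' \<and> finite (pverts H') \<and> card (pverts H') = card F
    \<and> parcs H' = {(x, y). x \<in> pverts H' \<and> y \<in> pverts H' \<and> x \<noteq> y}"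
  using assms
proof (induction "card (pverts H)" arbitrary: H F rule: less_induct)
  case less
  note fin = less.prems(1) and arcs = less.prems(2) and F = less.prems(3) and cover = less.prems(4)
  show ?case
  proof (cases "\<forall>X\<in>F. \<exists>x. X = {x}")
    case True
    have F_eq: "F = (\<lambda>x. {x}) ` pverts H"
    proof (intro equalityI subsetI)
      fix X assume "X \<in> F"
      then obtain x where "X = {x}" using True by blast
      moreover have "X \<subseteq> pverts H" using \<open>X \<in> F\<close> cover by blast
      ultimately show "X \<in> (\<lambda>x. {x}) ` pverts H" by simp
    next
      fix X assume "X \<in> (\<lambda>x. {x}) ` pverts H"
      then obtain x where x: "X = {x}" "x \<in> pverts H" by blast
      then obtain Y where Y: "Y \<in> F" "x \<in> Y" using cover by blast
      then obtain z where "Y = {z}" using True by blast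
      then show "X \<in> F" using x(1) Y by simp
    qed
    have sing: "{x} \<in> F" if "x \<in> pverts H" for x using that unfolding F_eq by blast
    have cF: "card F = card (pverts H)" unfolding F_eq by (simp add: card_image)
    have "adj H x y" if "x \<in> pverts H" "y \<in> pverts H" "x \<noteq> y" for x y
      using modelD(4)[OF F sing sing, of x y] that unfolding touch_def by simp
    then have "{(x, y). x \<in> pverts H \<and> y \<in> pverts H \<and> x \<noteq> y} \<subseteq> parcs H" by auto
    with arcs have "parcs H = {(x, y). x \<in> pverts H \<and> y \<in> pverts H \<and> x \<noteq> y}" by (rule equalityI)
    then show ?thesis using fin cF by (intro exI[of _ H]) simp
  next
    case False
    then obtain X where X: "X \<in> F" "\<nexists>x. X = {x}" by blast
    obtain u where u: "u \<in> X" using modelD(1)[OF F X(1)] by blast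
    then have "{u} \<noteq> X" using X(2) by blast
    then obtain v where v: "v \<in> X" "v \<noteq> u" and uv: "adj H u v"
      using modelD(2)[OF F X(1), unfolded conn_def, THEN spec, of "{u}"] u by blast
    define f where "f = (\<lambda>x. if x = v then u else x)"
    define H1 where "H1 = contract_edge H u v"
    have H1: "pverts H1 = f ` pverts H"
        "adj H1 p q \<longleftrightarrow> (\<exists>x y. adj H x y \<and> p = f x \<and> q = f y \<and> p \<noteq> q)" for p q
      unfolding H1_def contract_edge_def f_def Let_def by auto
    have uvH: "u \<in> pverts H" "v \<in> pverts H" using u v X(1) cover by blast+
    have pverts1: "pverts H1 = pverts H - {v}"
      unfolding H1(1) f_def using uvH v(2) by auto
    have edge: "adj H1 (f x) (f y)" if "adj H x y" "f x \<noteq> f y" for x y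
      using that H1(2) by blast
    have f_id: "f x = x" if "x \<noteq> v" for x using that unfolding f_def by simp
    have vY: "v \<notin> Y" if "Y \<in> F - {X}" for Y
      using modelD(3)[OF F X(1), of Y] that v(1) by auto
    have noloop: "x \<noteq> y" if "adj H x y" for x y using arcs that by blast
    have old: "adj H1 x y" if "x \<noteq> v" "y \<noteq> v" "adj H x y" for x y
      using edge[OF that(3)] f_id that(1,2) noloop[OF that(3)] by simp
    have oldY: "adj H1 y z" if "Y \<in> F - {X}" "Z \<in> F - {X}" "y \<in> Y" "z \<in> Z" "adj H y z" for Y Z y z
    proof (rule old[OF _ _ that(5)])
      show "y \<noteq> v" using vY[OF that(1)] that(3) by metis
      show "z \<noteq> v" using vY[OF that(2)] that(4) by metis
    qed
    have connX: "conn (adj H1) (X - {v})"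
      unfolding conn_def
    proof (intro allI impI)
      fix A assume A: "A \<subseteq> X - {v}" "A \<noteq> {}" "A \<noteq> X - {v}"
      \<comment> \<open>\<open>A'\<close> is the preimage of \<open>A\<close> in \<open>X\<close>
        under \<open>f\<close>; an edge of \<open>H\<close> from \<open>A'\<close> to the rest of
        \<open>X\<close> is mapped to one from \<open>A\<close> to the rest of
        \<open>X - {v}\<close>.\<close>
      define A' where "A' = (if u \<in> A then insert v A else A)"
      have "A' \<subseteq> X" "A' \<noteq> {}" "A' \<noteq> X" using A u v unfolding A'_def by (auto split: if_splits)
      then obtain a b where ab: "a \<in> A'" "b \<in> X - A'" "adj H a b"
        using modelD(2)[OF F X(1)] unfolding conn_def by blast
      have fa: "f a \<in> A" using ab(1) A(1) unfolding A'_def f_def by (auto split: if_splits)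
      have fb: "f b \<in> X - {v} - A"
        using ab(2) u v unfolding A'_def f_def by (auto split: if_splits)
      have "f a \<noteq> f b" using fa fb by (metis DiffD2)
      then have "adj H1 (f a) (f b)" by (rule edge[OF ab(3)])
      then show "\<exists>a\<in>A. \<exists>b\<in>X - {v} - A. adj H1 a b" using fa fb by blast
    qed
    have uX: "u \<in> X - {v}" using u v by simp
    define F1 where "F1 = insert (X - {v}) (F - {X})"
    have model1: "model (adj H1) F1"
      unfolding F1_def
    proof (rule model_insert)
      show "model (adj H1) (F - {X})"
      proof (rule modelI)
        fix Y assume Y: "Y \<in> F - {X}"
        show "Y \<noteq> {}" using modelD(1)[OF F] Y by blast
        have "conn (adj H) Y" using modelD(2)[OF F] Y by blast
        then show "conn (adj H1) Y" by (rule conn_mono) (rule oldY[OF Y Y])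
        fix Z assume Z: "Z \<in> F - {X}" "Y \<noteq> Z"
        show "Y \<inter> Z = {}" using modelD(3)[OF F, of Y Z] Y Z by simp
        have "touch (adj H) Y Z" using modelD(4)[OF F, of Y Z] Y Z by simp
        then obtain y z where yz: "y \<in> Y" "z \<in> Z" "adj H y z" unfolding touch_def by blast
        then have "adj H1 y z" by (rule oldY[OF Y Z(1)])
        then show "touch (adj H1) Y Z" using yz unfolding touch_def by blast
      qed
      show "X - {v} \<noteq> {}" using uX by blast
      show "conn (adj H1) (X - {v})" by (rule connX)
      fix Y assume Y: "Y \<in> F - {X}"
      have XY: "X \<inter> Y = {}" using modelD(3)[OF F X(1), of Y] Y by auto
      then show "(X - {v}) \<inter> Y = {}" by blast
      have fX: "f x \<in> X - {v}" if "x \<in> X" for x using that uX unfolding f_def by auto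
      have fY: "f y = y" if "y \<in> Y" for y using f_id[of y] that vY[OF Y] by metis
      have "touch (adj H) X Y" "touch (adj H) Y X"
        using modelD(4)[OF F X(1), of Y] modelD(4)[OF F, of Y X] X(1) Y by auto
      then obtain x y x' y' where xy: "x \<in> X" "y \<in> Y" "adj H x y" "x' \<in> X" "y' \<in> Y" "adj H y' x'"
        unfolding touch_def by blast
      have "f x \<noteq> f y" "f y' \<noteq> f x'" using fX fY xy XY by (metis DiffD1 disjoint_iff)+
      then have "adj H1 (f x) y" "adj H1 y' (f x')" using edge xy fY by metis+
      then show "touch (adj H1) (X - {v}) Y" "touch (adj H1) Y (X - {v})"
        using fX xy unfolding touch_def by blast+
    qed
    have cover1: "\<Union>F1 = pverts H1"
    proof -
      have "\<Union>(F - {X}) - {v} = \<Union>(F - {X})" using vY by blast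
      moreover have "\<Union>F = X \<union> \<Union>(F - {X})" using X(1) by blast
      ultimately show ?thesis unfolding F1_def pverts1 cover[symmetric] by blast
    qed
    have fin1: "finite (pverts H1)" and card1: "card (pverts H1) < card (pverts H)"
      using fin card_Diff1_less[OF fin uvH(2)] unfolding pverts1 by simp_all
    have arcs1: "parcs H1 \<subseteq> {(x, y). x \<in> pverts H1 \<and> y \<in> pverts H1 \<and> x \<noteq> y}"
    proof (intro subsetI, clarify)
      fix p q assume "adj H1 p q"
      then show "p \<in> pverts H1 \<and> q \<in> pverts H1 \<and> p \<noteq> q" using H1 arcs by blast
    qed
    obtain H' where H': "edge_contraction\<^sup>*\<^sup>* H1 H' \<and> finite (pverts H') \<and> card (pverts H') = card F1
        \<and> parcs H' = {(x, y). x \<in> pverts H' \<and> y \<in> pverts H' \<and> x \<noteq> y}"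
      using less.hyps[OF card1 fin1 arcs1 model1 cover1] by (rule exE)
    have "edge_contraction H H1" unfolding edge_contraction_def H1_def using uv by blast
    then have "edge_contraction\<^sup>*\<^sup>* H H'"
      using conjunct1[OF H'] by (rule converse_rtranclp_into_rtranclp)
    moreover have "card F1 = card F"
    proof -
      have finF: "finite F" using fin cover finite_UnionD by metis
      have "X - {v} \<notin> F - {X}"
      proof
        assume *: "X - {v} \<in> F - {X}"
        then have "X \<inter> (X - {v}) = {}" by (intro modelD(3)[OF F X(1)]) auto
        then show False using uX by blast
      qed
      then have "card F1 = Suc (card (F - {X}))" using finF unfolding F1_def by simp
      then show ?thesis using finF X(1) by (simp only: card_Suc_Diff1)
    qed
    ultimately show ?thesis using H' by (intro exI[of _ H']) simp
  qed
qed

lemma digraph_iso_complete_graph: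
  assumes "finite (pverts H)"
    and "parcs H = {(x, y). x \<in> pverts H \<and> y \<in> pverts H \<and> x \<noteq> y}"
  shows "digraph_iso (with_proj H) (with_proj (complete_graph (card (pverts H))))"
proof -
  obtain g where g: "bij_betw g (pverts H) {..<card (pverts H)}"
    using ex_bij_betw_finite_nat[OF assms(1)] unfolding atLeast0LessThan by (rule exE)
  define hom where "hom = \<lparr>iso_verts = g, iso_arcs = map_prod g g, iso_head = snd, iso_tail = fst\<rparr>"
  have inj: "inj_on g (pverts H)" and img: "g ` pverts H = {..<card (pverts H)}"
    using g unfolding bij_betw_def by auto
  have "pair_wf_digraph H" by unfold_locales (simp_all add: assms(2) split_beta)
  then have "wf_digraph (with_proj H)" by (simp add: wf_digraph_wp_iff)
  moreover have "inj_on (map_prod g g) (parcs H)"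
    by (rule inj_on_subset[OF map_prod_inj_on[OF inj inj]]) (auto simp: assms(2))
  ultimately have "pre_digraph.digraph_isomorphism (with_proj H) hom"
    unfolding pre_digraph.digraph_isomorphism_def hom_def using inj by simp
  moreover have "map_prod g g ` parcs H = parcs (complete_graph (card (pverts H)))"
  proof (intro equalityI subsetI)
    fix e assume "e \<in> map_prod g g ` parcs H"
    then obtain x y where xy: "e = (g x, g y)" "x \<in> pverts H" "y \<in> pverts H" "x \<noteq> y"
      unfolding assms(2) by force
    then have "g x \<in> g ` pverts H" "g y \<in> g ` pverts H" "g x \<noteq> g y"
      using inj by (simp_all add: inj_on_eq_iff)
    then show "e \<in> parcs (complete_graph (card (pverts H)))"
      unfolding img xy(1) complete_graph_def by simp
  next
    fix e assume "e \<in> parcs (complete_graph (card (pverts H)))"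
    then obtain i j where e: "e = (i, j)" "i \<in> g ` pverts H" "j \<in> g ` pverts H" "i \<noteq> j"
      unfolding img complete_graph_def by auto
    then obtain x y where "x \<in> pverts H" "y \<in> pverts H" "i = g x" "j = g y"
      by (elim imageE)
    then have "(x, y) \<in> parcs H" using e(4) unfolding assms(2) by auto
    then show "e \<in> map_prod g g ` parcs H"
      by (rule rev_image_eqI) (simp add: e(1) \<open>i = g x\<close> \<open>j = g y\<close>)
  qed
  ultimately have "with_proj (complete_graph (card (pverts H))) = app_iso hom (with_proj H)"
    unfolding app_iso_def hom_def with_proj_def by (simp add: img complete_graph_def)
  then show ?thesis
    using \<open>pre_digraph.digraph_isomorphism (with_proj H) hom\<close> unfolding digraph_iso_def by blast
qed

lemma is_minor_complete_graph:
  assumes G: "pair_graph G" and F: "model (adj G) F" "\<Union>F \<subseteq> pverts G"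
  shows "is_minor (complete_graph (card F)) G"
proof -
  interpret pair_graph G by (rule G)
  \<comment> \<open>The vertices outside the model are deleted, so that contraction ends with
    exactly one vertex per member.\<close>
  define H where "H = \<lparr>pverts = \<Union>F, parcs = {(x, y). adj G x y \<and> x \<in> \<Union>F \<and> y \<in> \<Union>F}\<rparr>"
  have pH: "pverts H = \<Union>F" and aH: "adj H x y \<longleftrightarrow> adj G x y \<and> x \<in> \<Union>F \<and> y \<in> \<Union>F" for x y
    unfolding H_def by auto
  have subarcs: "parcs H \<subseteq> parcs G" unfolding H_def by auto
  have symG: "adj G y x" if "adj G x y" for x y
    using pair_sym_arcs that unfolding symmetric_def by (auto dest: symD)
  have noloopG: "x \<noteq> y" if "adj G x y" for x y using pair_no_loops[OF that] by simp
  have finH: "finite (pverts H)" using F(2) pair_finite_verts unfolding pH by (rule finite_subset)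
  have "finite (parcs H)" using subarcs pair_finite_arcs by (rule finite_subset)
  moreover have "symmetric (with_proj H)"
    unfolding symmetric_def with_proj_simps by (rule symI) (use symG in \<open>simp add: aH\<close>)
  ultimately have pg: "pair_graph H"
    using finH by unfold_locales (auto simp: aH pH dest: noloopG)
  then have "pair_wf_digraph H" by (simp add: pair_graph_def pair_digraph_def pair_fin_digraph_def)
  then have sub: "subgraph (with_proj H) (with_proj G)"
    using subarcs F(2) wf_digraph unfolding subgraph_def compatible_def
    by (simp add: pH wf_digraph_wp_iff pair_wf_digraph_axioms)
  have modelH: "model (adj H) F"
  proof (rule modelI)
    fix X assume X: "X \<in> F"
    show "X \<noteq> {}" by (rule modelD(1)[OF F(1) X])
    show "conn (adj H) X"
      using modelD(2)[OF F(1) X] by (rule conn_mono) (use aH X in blast)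
    fix Y assume Y: "Y \<in> F" "X \<noteq> Y"
    show "X \<inter> Y = {}" using modelD(3)[OF F(1) X] Y by blast
    have "touch (adj G) X Y" using modelD(4)[OF F(1) X] Y by blast
    then show "touch (adj H) X Y" unfolding touch_def using aH X Y by blast
  qed
  have arcsH: "parcs H \<subseteq> {(x, y). x \<in> pverts H \<and> y \<in> pverts H \<and> x \<noteq> y}"
  proof (rule subrelI)
    fix x y assume xy: "adj H x y"
    then have "x \<noteq> y" using noloopG[of x y] aH by blast
    with xy show "(x, y) \<in> {(x, y). x \<in> pverts H \<and> y \<in> pverts H \<and> x \<noteq> y}"
      unfolding aH pH by simp
  qed
  obtain H' where H': "edge_contraction\<^sup>*\<^sup>* H H' \<and> finite (pverts H') \<and> card (pverts H') = card F
      \<and> parcs H' = {(x, y). x \<in> pverts H' \<and> y \<in> pverts H' \<and> x \<noteq> y}"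
    using contract_edge_to_complete[OF finH arcsH modelH pH[symmetric]] by (rule exE)
  then have "digraph_iso (with_proj H') (with_proj (complete_graph (card F)))"
    using digraph_iso_complete_graph[of H'] by simp
  then show ?thesis
    unfolding is_minor_def using pg sub H' by (intro exI[of _ H] exI[of _ H'] conjI) simp_all
qed

theorem theorem1:
  fixes G :: "'a pair_pre_digraph" and n :: nat and r :: int
  assumes "pair_graph G"
    and "n = card (pverts G)" and "n \<ge> 1"
    and "r = 2 * int (independence_number G)
             - \<lceil>log tau (tau * real (independence_number G) / 2)\<rceil>"
  shows "is_minor (complete_graph (nat \<lceil>real n / real_of_int r\<rceil>)) G"
proof -
  interpret G: pair_graph G by (rule assms(1))
  let ?V = "pverts G" and ?E = "adj G"
  have graph: "fin_graph ?V ?E"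
  proof
    show "finite ?V" by (rule G.pair_finite_verts)
    show "adj G y x" if "adj G x y" for x y
      using G.pair_sym_arcs that unfolding symmetric_def by (auto dest: symD)
    show "\<not> adj G x x" for x using G.pair_no_loops[of "(x, x)"] by auto
  qed
  let ?M = "{F. model ?E F \<and> \<Union>F \<subseteq> ?V}"
  have "?M \<subseteq> Pow (Pow ?V)" by blast
  then have finM: "finite ?M" by (rule finite_subset) (simp add: G.pair_finite_verts)
  have "{} \<in> ?M" by (simp add: model_def)
  then have neM: "?M \<noteq> {}" by blast
  define h where "h = Max (card ` ?M)"
  have "h \<in> card ` ?M" unfolding h_def using finM neM by (intro Max_in) simp_all
  then obtain F where hF: "h = card F" and "F \<in> ?M" by (rule imageE)
  then have F: "model ?E F" "\<Union>F \<subseteq> ?V" by simp_all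
  interpret G: fin_graph_bound ?V ?E h
  proof (intro fin_graph_bound.intro fin_graph_bound_axioms.intro graph)
    fix F' assume "model ?E F'" "\<Union>F' \<subseteq> ?V"
    then show "card F' \<le> h" unfolding h_def using finM by (intro Max_ge) simp_all
  qed
  define a where "a = G.alpha ?V"
  have ind: "independence_number G = a"
    unfolding independence_number_def independent_set_def a_def G.alpha_def indep_def ..
  have "?V \<noteq> {}" using assms(2,3) by auto
  then have "0 < a" unfolding a_def by (intro G.alpha_pos G.pair_finite_verts)
  then have "cost lsav a \<le> r"
    using ceiling_log_tau_le[of a] assms(4) unfolding ind cost_def by linarith
  \<comment> \<open>This makes \<open>r\<close> positive, so that dividing by it preserves the
    inequality.\<close>
  moreover have "0 < cost lsav a" using lsav_le[of a] \<open>0 < a\<close> unfolding cost_def by linarith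
  moreover have "int n \<le> cost lsav a * int h"
    using G.card_le_cost_mult unfolding assms(2) a_def .
  ultimately have r: "0 < r" "int n \<le> r * int h"
    using mult_right_mono[of "cost lsav a" r "int h"] by linarith+
  then have "real n \<le> real_of_int r * real h"
    by (metis of_int_le_iff of_int_mult of_int_of_nat_eq)
  then have "real n / real_of_int r \<le> real h" using r(1) by (simp add: field_simps)
  then have "nat \<lceil>real n / real_of_int r\<rceil> \<le> card F" unfolding hF[symmetric] by (simp add: ceiling_le_iff)
  then obtain F' where F': "F' \<subseteq> F" "card F' = nat \<lceil>real n / real_of_int r\<rceil>"
    by (meson obtain_subset_with_card_n)
  have "model ?E F'" "\<Union>F' \<subseteq> ?V" using model_subset[OF F(1) F'(1)] F(2) F'(1) by blast+
  then show ?thesis using is_minor_complete_graph[OF assms(1), of F'] unfolding F'(2) by simp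
qed

end
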